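(* For positive integers $n$ and integers $k \geq 0$, let $MOP(n,k)$ denote the minimum of $sp(G,k)$ over all maximal outerplanar graphs $G$ on $n$ vertices. Then: \begin{enumerate} \item $MOP(n,0) > \dfrac{n}{5}$; \item $MOP(n,1) \geq \dfrac{n}{3} + 1$; \item $MOP(n,2) \geq \dfrac{4n}{9}$, and $MOP(n,2) \leq \dfrac{5n+19}{11}$ for every $n$ of the form $n = 11p+5$ with $p \geq 2$ an integer; \item for every integer $k \geq 3$, $MOP(n,k) \geq \dfrac{(k-2)n}{k-1}$. \end{enumerate} Moreover, bounds 1 and 2 are sharp up to additive constants: there is an absolute constant $C$ such that for infinitely many $n$ one has $MOP(n,0) \leq \frac{n}{5} + C$, and for infinitely many $n$ one has $MOP(n,1) \leq \frac{n}{3} + C$.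
   Context: A maximal outerplanar graph is a simple outerplanar graph to which no edge can be added while preserving outerplanarity. For a graph $G=(V,E)$ and a subset $B \subseteq V$, the spread of $B$ is $sp(B) = \max_{u \in B} \deg(u) - \min_{v \in B} \deg(v)$, where degrees are taken in $G$. For an integer $k \geq 0$, $sp(G,k)$ is the maximum cardinality of a subset $B \subseteq V$ with $sp(B) \leq k$.
   Formalization: Bound 2, MOP(n,1) ≥ n/3 + 1, is stated for n ≥ 2 only: for n = 1 the single-vertex graph is maximal outerplanar and MOP(1,1) = 1 < 4/3, so the claim fails there. *)

theory Defs
  imports "HOL-Analysis.Analysis"
begin

text \<open>A finite simple graph is given by its vertex set \<open>V\<close> and its set \<open>E\<close> of edges, each edge
  being the two-element set of its endpoints.\<close>

definition simple_graph :: "'a set \<Rightarrow> 'a set set \<Rightarrow> bool" where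
  "simple_graph V E \<longleftrightarrow> finite V \<and> (\<forall>e\<in>E. e \<subseteq> V \<and> card e = 2)"

definition degree :: "'a set set \<Rightarrow> 'a \<Rightarrow> nat" where
  "degree E v = card {e \<in> E. v \<in> e}"

text \<open>A plane drawing places the vertices at distinct points and draws each edge as a simple arc
  joining its endpoints; an arc passes through no other vertex, and two different arcs meet at most
  in a common endpoint.\<close>

definition plane_drawing ::
    "'a set \<Rightarrow> 'a set set \<Rightarrow> ('a \<Rightarrow> complex) \<Rightarrow> ('a set \<Rightarrow> real \<Rightarrow> complex) \<Rightarrow> bool" where
  "plane_drawing V E pos \<gamma> \<longleftrightarrow>
     inj_on pos V \<and>
     (\<forall>e\<in>E. arc (\<gamma> e) \<and> {pathstart (\<gamma> e), pathfinish (\<gamma> e)} = pos ` e \<and>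
             path_image (\<gamma> e) \<inter> pos ` V = pos ` e) \<and>
     (\<forall>e\<in>E. \<forall>f\<in>E. e \<noteq> f \<longrightarrow> path_image (\<gamma> e) \<inter> path_image (\<gamma> f) = pos ` (e \<inter> f))"

definition drawing_image ::
    "'a set \<Rightarrow> 'a set set \<Rightarrow> ('a \<Rightarrow> complex) \<Rightarrow> ('a set \<Rightarrow> real \<Rightarrow> complex) \<Rightarrow> complex set" where
  "drawing_image V E pos \<gamma> = pos ` V \<union> (\<Union>e\<in>E. path_image (\<gamma> e))"

text \<open>The drawing of a finite graph is compact, so \<^const>\<open>outside\<close> of it is the unique unbounded
  component of its complement, i.e. the outer face.\<close>

definition outerplanar :: "'a set \<Rightarrow> 'a set set \<Rightarrow> bool" where
  "outerplanar V E \<longleftrightarrow>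
     (\<exists>pos \<gamma>. plane_drawing V E pos \<gamma> \<and>
             pos ` V \<subseteq> frontier (outside (drawing_image V E pos \<gamma>)))"

definition maximal_outerplanar :: "'a set \<Rightarrow> 'a set set \<Rightarrow> bool" where
  "maximal_outerplanar V E \<longleftrightarrow>
     simple_graph V E \<and> outerplanar V E \<and>
     (\<forall>u\<in>V. \<forall>v\<in>V. u \<noteq> v \<and> {u, v} \<notin> E \<longrightarrow> \<not> outerplanar V (insert {u, v} E))"

definition spread :: "'a set set \<Rightarrow> 'a set \<Rightarrow> nat" where
  "spread E B = Max (degree E ` B) - Min (degree E ` B)"

text \<open>The spread of the empty set is meaningless, so only nonempty \<open>B\<close> compete; for nonempty \<open>V\<close>
  singletons always qualify.\<close>

definition sp :: "'a set \<Rightarrow> 'a set set \<Rightarrow> nat \<Rightarrow> nat" where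
  "sp V E k = Max {card B | B. B \<subseteq> V \<and> B \<noteq> {} \<and> spread E B \<le> k}"

text \<open>Up to isomorphism every finite graph has its vertices in \<^typ>\<open>nat\<close>. On a nonempty set of
  naturals \<^const>\<open>Inf\<close> is the minimum.\<close>

definition MOP :: "nat \<Rightarrow> nat \<Rightarrow> nat" where
  "MOP n k = Inf {sp V E k | (V :: nat set) E. maximal_outerplanar V E \<and> card V = n}"

end

theory Submission
  imports Defs
begin

text \<open>
  In a plane drawing with all vertices on the outer face, three internally disjoint paths with common
  ends cannot all have inner vertices (by Janiszewski's theorem one of the three arcs of a theta curve
  lies inside the closed curve formed by the other two), and a cycle cannot have two crossing chords.
  Excluding these two configurations already forces a linear order of the vertices in which no two
  edges cross: a graph without cut vertices then has a Hamiltonian cycle, and cut vertices are handled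
  by gluing. Conversely, placing the vertices on a parabola turns such an order into an outerplanar
  straight-line drawing. Hence an outerplanar graph has at most \<open>2n - 3\<close> edges, and a maximal one
  contains a Hamiltonian cycle.

  The lower bounds for \<open>k \<le> 2\<close> weigh the degrees, which are at least 2 and sum to at most \<open>4n - 6\<close>.
  For \<open>k \<ge> 3\<close> let \<open>H\<close> be the set of the \<open>h\<close> vertices of degree at least \<open>k + 3\<close>. It spans at most \<open>2h\<close>
  edges and misses at least \<open>n - 2h\<close> edges of the Hamiltonian cycle, so its degree sum is at most
  \<open>2h + (2n - 3) - (n - 2h) \<le> n + 4h\<close>, whence \<open>(k - 1) h \<le> n\<close>. The upper bounds come from
  triangulated strips that repeat a block of 5, 3 and 11 vertices respectively.
\<close>

section \<open>Theta curves and crossing chords\<close>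

text \<open>Maximality speaks about every drawing of an enlarged graph, so no single drawing lets
  one use it or verify it; a vertex order without crossings does both. The weights top each degree
  up to a constant and are constant on windows of \<open>k + 1\<close> degrees, so \<open>sp\<close>
  bounds their sum. Equality would asymptotically force the degrees 2 to 6 equally often for
  \<open>k = 0\<close>, and 2, 4, 6 equally often for \<open>k = 1\<close>; the blocks of 5 and 3
  vertices have exactly these degrees. For \<open>k = 2\<close> it would force 2, 5, 8 in the
  proportion 4 : 4 : 1, whereas the block of 11 vertices has 5, 4, 1, 1 vertices of degree 2, 5, 6,
  8, which leaves the gap between 4/9 and 5/11. For \<open>k > 3\<close> the degree sum over all
  vertices is too weak: it allows up to about \<open>2 n / (k + 1)\<close> vertices of degree at
  least \<open>k + 3\<close>. That is why the sum is restricted to these vertices.\<close>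

lemma theta_curve_Jordan:
  fixes c1 c2 :: "real \<Rightarrow> complex"
  assumes "arc c1" "pathstart c1 = a" "pathfinish c1 = b"
    and "arc c2" "pathstart c2 = a" "pathfinish c2 = b"
    and "path_image c1 \<inter> path_image c2 = {a, b}"
  defines "S \<equiv> path_image c1 \<union> path_image c2"
  shows "inside S \<noteq> {}" "open (inside S)" "connected (inside S)" "connected (outside S)"
    "frontier (inside S) = S" "compact S" "open (outside S)"
proof -
  have sp: "simple_path (c1 +++ reversepath c2)"
    using assms by (intro simple_path_join_loop) (auto simp: arc_reversepath)
  have pim: "path_image (c1 +++ reversepath c2) = S"
    using assms by (simp add: path_image_join S_def)
  have cl: "pathfinish (c1 +++ reversepath c2) = pathstart (c1 +++ reversepath c2)"
    using assms by simp
  show "inside S \<noteq> {}" "open (inside S)" "connected (inside S)" "connected (outside S)"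
    "frontier (inside S) = S" "open (outside S)"
    using Jordan_inside_outside[OF sp cl] unfolding pim by auto
  show "compact S" using sp pim compact_simple_path_image by metis
qed

text \<open>Without its ends the arc is connected and avoids \<open>S\<close>, so it cannot meet
  both of the disjoint open sets \<open>inside S\<close> and \<open>outside S\<close>.\<close>

lemma arc_interior_inside:
  fixes c :: "real \<Rightarrow> complex"
  assumes "arc c" "pathstart c = a" "pathfinish c = b" "closed S"
    and "path_image c \<inter> S = {a, b}" "p \<in> path_image c" "p \<in> inside S"
  shows "path_image c - {a, b} \<subseteq> inside S"
proof -
  have con: "connected (path_image c - {a, b})"
    using connected_simple_path_endless[of c] assms arc_imp_simple_path by blast
  have sub: "path_image c - {a, b} \<subseteq> inside S \<union> outside S"
    using assms(5) by (auto simp: inside_Un_outside)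
  have "p \<notin> {a, b}" using assms(5,7) inside_no_overlap[of S] by blast
  then have "inside S \<inter> (path_image c - {a, b}) \<noteq> {}" using assms by auto
  moreover have "inside S \<inter> outside S \<inter> (path_image c - {a, b}) = {}" by simp
  ultimately have "outside S \<inter> (path_image c - {a, b}) = {}"
    using connectedD[OF con, of "inside S" "outside S"] sub assms(4)
    by (metis open_inside open_outside)
  then show ?thesis using sub by blast
qed

text \<open>Otherwise the second arc avoids the inside of the closed curve formed by the other two,
  and that inside lies outside both remaining curves. Its points can then be joined to a far point
  avoiding either of these curves. The two curves meet in the second arc, which is connected, so the
  points can be joined avoiding all three arcs, which is impossible from inside a closed
  curve.\<close>

lemma theta_curve:
  fixes c1 c2 c3 :: "real \<Rightarrow> complex"
  assumes c1: "arc c1" "pathstart c1 = a" "pathfinish c1 = b"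
    and c2: "arc c2" "pathstart c2 = a" "pathfinish c2 = b"
    and c3: "arc c3" "pathstart c3 = a" "pathfinish c3 = b"
    and i12: "path_image c1 \<inter> path_image c2 = {a, b}"
    and i13: "path_image c1 \<inter> path_image c3 = {a, b}"
    and i23: "path_image c2 \<inter> path_image c3 = {a, b}"
    and p: "p1 \<in> path_image c1 - {a, b}" "p2 \<in> path_image c2 - {a, b}" "p3 \<in> path_image c3 - {a, b}"
  shows "p1 \<in> inside (path_image c2 \<union> path_image c3) \<or>
         p2 \<in> inside (path_image c1 \<union> path_image c3) \<or>
         p3 \<in> inside (path_image c1 \<union> path_image c2)"
proof (rule ccontr)
  define A B C where "A = path_image c1" and "B = path_image c2" and "C = path_image c3"
  assume "\<not> ?thesis"
  then have n: "p1 \<notin> inside (B \<union> C)" "p2 \<notin> inside (A \<union> C)" "p3 \<notin> inside (A \<union> B)"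
    by (auto simp: A_def B_def C_def)
  note AB = theta_curve_Jordan[OF c1 c2 i12, folded A_def B_def]
  note AC = theta_curve_Jordan[OF c1 c3 i13, folded A_def C_def]
  note BC = theta_curve_Jordan[OF c2 c3 i23, folded B_def C_def]
  have clo: "closed (A \<union> C)" "closed (A \<union> B)" using AC(6) AB(6) compact_imp_closed by blast+
  have ii: "B \<inter> (A \<union> C) = {a, b}" "C \<inter> (A \<union> B) = {a, b}"
    using i12 i13 i23 unfolding A_def B_def C_def by blast+
  have mB: "B \<inter> inside (A \<union> C) = {}"
    using arc_interior_inside[OF c2 clo(1) ii(1)[unfolded B_def]] n(2) p(2) unfolding B_def by blast
  \<comment> \<open>The connected set \<open>inside S'\<close> misses \<open>S\<close>, so it lies
    on one side of it; the boundary point \<open>q\<close>, which is neither on \<open>S\<close> nor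
    inside it, decides for the outer side.\<close>
  have sub: "inside S' \<subseteq> outside S" if "inside S' \<inter> S = {}" "connected (inside S')" "q \<in> frontier (inside S')"
    "q \<notin> inside S" "q \<notin> S" "closed S" for S S' :: "complex set" and q
  proof -
    have "inside S' \<subseteq> inside S \<union> outside S" using that(1) by auto
    moreover have "inside S \<inter> outside S \<inter> inside S' = {}" by simp
    ultimately have "inside S \<inter> inside S' = {} \<or> outside S \<inter> inside S' = {}"
      using connectedD[OF that(2), of "inside S" "outside S"] that(6) by (metis open_inside open_outside)
    moreover have False if "outside S \<inter> inside S' = {}"
    proof -
      have "inside S' \<subseteq> inside S" using that \<open>inside S' \<subseteq> inside S \<union> outside S\<close> by blast
      then have "q \<in> closure (inside S)"
        using \<open>q \<in> frontier (inside S')\<close> closure_mono[of "inside S'" "inside S"]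
        unfolding frontier_def by blast
      then have "q \<in> inside S \<union> S"
        using closure_inside_subset[OF \<open>closed S\<close>] by blast
      then show False using \<open>q \<notin> inside S\<close> \<open>q \<notin> S\<close> by auto
    qed
    ultimately show ?thesis using \<open>inside S' \<subseteq> inside S \<union> outside S\<close> by blast
  qed
  obtain x where x: "x \<in> inside (A \<union> C)" using AC(1) by auto
  have d: "inside (A \<union> C) \<inter> (A \<union> C) = {}" using inside_no_overlap by blast
  have "inside (A \<union> C) \<subseteq> outside (A \<union> B)"
  proof (rule sub[of _ _ p3])
    show "inside (A \<union> C) \<inter> (A \<union> B) = {}" using d mB by blast
    show "p3 \<in> frontier (inside (A \<union> C))" "p3 \<notin> A \<union> B"
      using p(3) i13 i23 AC(5) unfolding A_def B_def C_def by blast+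
  qed (use AC(3) n(3) AB(6) in \<open>auto simp: compact_imp_closed\<close>)
  then have x1: "x \<in> outside (A \<union> B)" using x by auto
  have "inside (A \<union> C) \<subseteq> outside (B \<union> C)"
  proof (rule sub[of _ _ p1])
    show "inside (A \<union> C) \<inter> (B \<union> C) = {}" using d mB by blast
    show "p1 \<in> frontier (inside (A \<union> C))" "p1 \<notin> B \<union> C"
      using p(1) i12 i13 AC(5) unfolding A_def B_def C_def by blast+
  qed (use AC(3) n(1) BC(6) in \<open>auto simp: compact_imp_closed\<close>)
  then have x2: "x \<in> outside (B \<union> C)" using x by auto
  have "bounded (A \<union> B \<union> C)" using compact_imp_bounded[OF AB(6)] compact_imp_bounded[OF BC(6)] by simp
  then have "outside (A \<union> B \<union> C) \<noteq> {}"
    by (rule outside_bounded_nonempty)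
  \<comment> \<open>\<open>y\<close> plays the role of the point at infinity: it lies outside all
    three closed curves at once.\<close>
  then obtain y where y: "y \<in> outside (A \<union> B \<union> C)" by auto
  then have y': "y \<in> outside (A \<union> B)" "y \<in> outside (B \<union> C)" "y \<in> outside (A \<union> C)"
    using outside_mono[of "A \<union> B" "A \<union> B \<union> C"] outside_mono[of "B \<union> C" "A \<union> B \<union> C"]
      outside_mono[of "A \<union> C" "A \<union> B \<union> C"] by auto
  have "connected_component (- (A \<union> B)) x y"
    unfolding connected_component_def
    by (rule exI[of _ "outside (A \<union> B)"]) (use AB(4) x1 y' in \<open>auto simp: outside_def\<close>)
  moreover have "connected_component (- (B \<union> C)) x y"
    unfolding connected_component_def
    by (rule exI[of _ "outside (B \<union> C)"]) (use BC(4) x2 y' in \<open>auto simp: outside_def\<close>)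
  moreover have "connected ((A \<union> B) \<inter> (B \<union> C))"
  proof -
    have "(A \<union> B) \<inter> (B \<union> C) = B" using i13 i12 unfolding A_def B_def C_def by blast
    then show ?thesis using c2 B_def arc_imp_simple_path connected_simple_path_image by metis
  qed
  ultimately have "connected_component (- ((A \<union> B) \<union> (B \<union> C))) x y"
    using Janiszewski[OF AB(6) compact_imp_closed[OF BC(6)]] by blast
  then have "connected_component (- (A \<union> C)) x y"
    by (rule connected_component_of_subset) auto
  then have "y \<in> inside (A \<union> C)" using x inside_same_component by blast
  then show False using y' inside_Int_outside by blast
qed

text \<open>The point is a limit of points of \<open>outside D\<close>, hence of
  \<open>outside S\<close>, whereas \<open>inside S\<close> is open. This is the form in which the
  outer face condition on the vertices is used.\<close>

lemma outer_not_inside: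
  assumes "p \<in> frontier (outside D)" "S \<subseteq> D" "closed S"
  shows "p \<notin> inside (S :: complex set)"
proof
  assume "p \<in> inside S"
  moreover have "p \<in> closure (outside D)" using assms(1) frontier_def by blast
  ultimately obtain q where "q \<in> inside S" "q \<in> outside D"
    using open_inside[OF assms(3)] closure_iff_nhds_not_empty
    by (metis disjoint_iff subset_refl)
  then show False using outside_mono[OF assms(2)] inside_Int_outside by blast
qed

lemma no_outer_theta:
  fixes c1 c2 c3 :: "real \<Rightarrow> complex"
  assumes "arc c1" "pathstart c1 = a" "pathfinish c1 = b"
    and "arc c2" "pathstart c2 = a" "pathfinish c2 = b"
    and "arc c3" "pathstart c3 = a" "pathfinish c3 = b"
    and "path_image c1 \<inter> path_image c2 = {a, b}"
    and "path_image c1 \<inter> path_image c3 = {a, b}"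
    and "path_image c2 \<inter> path_image c3 = {a, b}"
    and "p1 \<in> path_image c1 - {a, b}" "p2 \<in> path_image c2 - {a, b}" "p3 \<in> path_image c3 - {a, b}"
    and "path_image c1 \<union> path_image c2 \<union> path_image c3 \<subseteq> D"
    and "{p1, p2, p3} \<subseteq> frontier (outside D)"
  shows False
proof -
  have "closed (path_image c1)" "closed (path_image c2)" "closed (path_image c3)"
    using assms(1,4,7) closed_arc_image by blast+
  then show False
    using theta_curve[OF assms(1-15)] assms(16,17)
      outer_not_inside[of p1 D "path_image c2 \<union> path_image c3"]
      outer_not_inside[of p2 D "path_image c1 \<union> path_image c3"]
      outer_not_inside[of p3 D "path_image c1 \<union> path_image c2"] by auto
qed

text \<open>Of the three alternatives of \<open>theta_curve\<close>, the outer points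
  \<open>p1\<close> and \<open>p2\<close> exclude two, so it is the chord that runs inside.\<close>

lemma chord_inside:
  fixes c1 c2 c :: "real \<Rightarrow> complex"
  assumes "arc c1" "pathstart c1 = a" "pathfinish c1 = b"
    and "arc c2" "pathstart c2 = a" "pathfinish c2 = b"
    and c: "arc c" "pathstart c = a" "pathfinish c = b"
    and "path_image c1 \<inter> path_image c2 = {a, b}"
    and "path_image c1 \<inter> path_image c = {a, b}"
    and "path_image c2 \<inter> path_image c = {a, b}"
    and "p1 \<in> path_image c1 - {a, b}" "p2 \<in> path_image c2 - {a, b}"
    and D: "path_image c1 \<union> path_image c2 \<union> path_image c \<subseteq> D"
    and "{p1, p2} \<subseteq> frontier (outside D)"
  shows "path_image c - {a, b} \<subseteq> inside (path_image c1 \<union> path_image c2)"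
proof -
  have cl: "closed (path_image c1)" "closed (path_image c2)" "closed (path_image c)"
    using assms(1,4,7) closed_arc_image by blast+
  obtain p where p: "p \<in> path_image c - {a, b}"
    using c by (metis arc_imp_simple_path simple_path_endless nonempty_simple_path_endless ex_in_conv)
  have "p \<in> inside (path_image c1 \<union> path_image c2)"
    using theta_curve[OF assms(1-14) p] assms(15,16) cl
      outer_not_inside[of p1 D "path_image c2 \<union> path_image c"]
      outer_not_inside[of p2 D "path_image c1 \<union> path_image c"] by auto
  moreover have "path_image c \<inter> (path_image c1 \<union> path_image c2) = {a, b}"
    using assms by blast
  ultimately show ?thesis
    using arc_interior_inside[OF c, of "path_image c1 \<union> path_image c2" p] cl p by blast
qed

lemma arc_endpoint_closure:
  fixes c :: "real \<Rightarrow> complex"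
  assumes "arc c" "pathstart c = a" "pathfinish c = b" "p \<in> {a, b}"
  shows "p \<in> closure (path_image c - {a, b})"
proof -
  have "connected (path_image c)" using assms arc_imp_simple_path connected_simple_path_image by blast
  moreover have "p \<in> path_image c" "a \<in> path_image c" "b \<in> path_image c" "a \<noteq> b"
    using assms arc_distinct_ends[of c] by auto
  ultimately have "p islimpt path_image c"
    using connected_imp_perfect[of "path_image c" p] by fastforce
  moreover have "path_image c = {a, b} \<union> (path_image c - {a, b})"
    using \<open>a \<in> path_image c\<close> \<open>b \<in> path_image c\<close> by blast
  ultimately have "p islimpt ({a, b} \<union> (path_image c - {a, b}))" by simp
  then have "p islimpt (path_image c - {a, b})"
    using islimpt_Un_finite[of "{a, b}" p "path_image c - {a, b}"] by blast
  then show ?thesis by (simp add: closure_def)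
qed

text \<open>Both chords run inside the cycle. The first cuts the inside into two regions, and the
  second, being connected and disjoint from the first, stays in one of them. Both of its ends then
  lie in the closure of that region, but \<open>b\<close> and \<open>d\<close> are on different
  sides of the first chord.\<close>

lemma no_outer_crossing_chords:
  fixes ab bc cd da ac bd :: "real \<Rightarrow> complex"
  assumes ab: "arc ab" "pathstart ab = a" "pathfinish ab = b"
    and bc: "arc bc" "pathstart bc = b" "pathfinish bc = c"
    and cd: "arc cd" "pathstart cd = c" "pathfinish cd = d"
    and da: "arc da" "pathstart da = d" "pathfinish da = a"
    and ac: "arc ac" "pathstart ac = a" "pathfinish ac = c"
    and bd: "arc bd" "pathstart bd = b" "pathfinish bd = d"
    and cyc: "path_image ab \<inter> path_image bc = {b}" "path_image bc \<inter> path_image cd = {c}"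
      "path_image cd \<inter> path_image da = {d}" "path_image da \<inter> path_image ab = {a}"
      "path_image ab \<inter> path_image cd = {}" "path_image bc \<inter> path_image da = {}"
    and iac: "path_image ab \<inter> path_image ac = {a}" "path_image bc \<inter> path_image ac = {c}"
      "path_image cd \<inter> path_image ac = {c}" "path_image da \<inter> path_image ac = {a}"
    and ibd: "path_image ab \<inter> path_image bd = {b}" "path_image bc \<inter> path_image bd = {b}"
      "path_image cd \<inter> path_image bd = {d}" "path_image da \<inter> path_image bd = {d}"
    and icr: "path_image ac \<inter> path_image bd = {}"
    and D: "path_image ab \<union> path_image bc \<union> path_image cd \<union> path_image da
      \<union> path_image ac \<union> path_image bd \<subseteq> D"
    and outer: "{a, b, c, d} \<subseteq> frontier (outside D)"
  shows False
proof -
  \<comment> \<open>The same cycle is cut at \<open>a\<close>, \<open>c\<close> into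
    \<open>c1\<close>, \<open>c2\<close> and at \<open>b\<close>, \<open>d\<close> into
    \<open>e1\<close>, \<open>e2\<close>, so that each chord joins the common ends of two
    arcs.\<close>
  define c1 c2 e1 e2 where "c1 = ab +++ bc" and "c2 = reversepath (cd +++ da)"
    and "e1 = reversepath (da +++ ab)" and "e2 = bc +++ cd"
  have ends: "a \<in> path_image ab" "a \<in> path_image da" "a \<in> path_image ac" "b \<in> path_image ab"
    "b \<in> path_image bc" "b \<in> path_image bd" "c \<in> path_image bc" "c \<in> path_image cd" "c \<in> path_image ac"
    "d \<in> path_image cd" "d \<in> path_image da" "d \<in> path_image bd"
    using ab bc cd da ac bd by (metis pathstart_in_path_image pathfinish_in_path_image)+
  have c1: "arc c1" "pathstart c1 = a" "pathfinish c1 = c" "path_image c1 = path_image ab \<union> path_image bc"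
    using ab bc cyc by (auto simp: c1_def path_image_join intro!: arc_join)
  have c2: "arc c2" "pathstart c2 = a" "pathfinish c2 = c" "path_image c2 = path_image cd \<union> path_image da"
    using cd da cyc by (auto simp: c2_def path_image_join intro!: arc_join arc_reversepath)
  have e1: "arc e1" "pathstart e1 = b" "pathfinish e1 = d" "path_image e1 = path_image da \<union> path_image ab"
    using da ab cyc by (auto simp: e1_def path_image_join intro!: arc_join arc_reversepath)
  have e2: "arc e2" "pathstart e2 = b" "pathfinish e2 = d" "path_image e2 = path_image bc \<union> path_image cd"
    using bc cd cyc by (auto simp: e2_def path_image_join intro!: arc_join)
  have ne: "b \<noteq> a" "b \<noteq> c" "d \<noteq> a" "d \<noteq> c" "a \<noteq> c" "b \<noteq> d"
    using arc_distinct_ends ab bc cd da ac bd by metis+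
  note meets = cyc iac ibd icr trans[OF Int_commute cyc(1)] trans[OF Int_commute cyc(2)]
    trans[OF Int_commute cyc(3)] trans[OF Int_commute cyc(4)] trans[OF Int_commute cyc(5)]
    trans[OF Int_commute cyc(6)]
  have i: "path_image c1 \<inter> path_image c2 = {a, c}" "path_image c1 \<inter> path_image ac = {a, c}"
    "path_image c2 \<inter> path_image ac = {a, c}"
    unfolding c1(4) c2(4) Int_Un_distrib Int_Un_distrib2 by (simp_all only: meets) auto
  have j: "path_image e1 \<inter> path_image e2 = {b, d}" "path_image e1 \<inter> path_image bd = {b, d}"
    "path_image e2 \<inter> path_image bd = {b, d}"
    unfolding e1(4) e2(4) Int_Un_distrib Int_Un_distrib2 by (simp_all only: meets) auto
  let ?C = "path_image c1 \<union> path_image c2"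
  have inac: "path_image ac - {a, c} \<subseteq> inside ?C"
  proof (rule chord_inside[OF c1(1-3) c2(1-3) ac i])
    show "b \<in> path_image c1 - {a, c}" "d \<in> path_image c2 - {a, c}"
      using ends ne c1 c2 by auto
    show "path_image c1 \<union> path_image c2 \<union> path_image ac \<subseteq> D" "{b, d} \<subseteq> frontier (outside D)"
      using D outer c1 c2 by auto
  qed
  have inbd: "path_image bd - {b, d} \<subseteq> inside (path_image e1 \<union> path_image e2)"
  proof (rule chord_inside[OF e1(1-3) e2(1-3) bd j])
    show "a \<in> path_image e1 - {b, d}" "c \<in> path_image e2 - {b, d}"
      using ends ne e1 e2 by auto
    show "path_image e1 \<union> path_image e2 \<union> path_image bd \<subseteq> D" "{a, c} \<subseteq> frontier (outside D)"
      using D outer e1 e2 by auto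
  qed
  have "path_image e1 \<union> path_image e2 = ?C" using c1 c2 e1 e2 by auto
  then have inbd: "path_image bd - {b, d} \<subseteq> inside ?C" using inbd by simp
  obtain q where "q \<in> path_image ac - {a, c}"
    using ac by (metis arc_imp_simple_path simple_path_endless nonempty_simple_path_endless ex_in_conv)
  then have "path_image ac \<inter> inside ?C \<noteq> {}" using inac by auto
  then obtain dis: "inside (path_image c1 \<union> path_image ac) \<inter> inside (path_image c2 \<union> path_image ac) = {}"
    and un: "inside (path_image c1 \<union> path_image ac) \<union> inside (path_image c2 \<union> path_image ac) \<union>
           (path_image ac - {a, c}) = inside ?C"
    by (rule split_inside_simple_closed_curve[OF arc_imp_simple_path[OF c1(1)] c1(2,3)
          arc_imp_simple_path[OF c2(1)] c2(2,3) arc_imp_simple_path[OF ac(1)] ac(2,3) ne(5) i])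
  let ?I = "inside (path_image c1 \<union> path_image ac)" and ?J = "inside (path_image c2 \<union> path_image ac)"
  have cl: "closed (path_image c1 \<union> path_image ac)" "closed (path_image c2 \<union> path_image ac)"
    using c1(1) c2(1) ac(1) by (auto simp: closed_arc_image intro!: closed_Un)
  have con: "connected (path_image bd - {b, d})"
    using connected_simple_path_endless[of bd] bd arc_imp_simple_path by blast
  have sub: "path_image bd - {b, d} \<subseteq> ?I \<union> ?J" using inbd un icr by blast
  then have "?I \<inter> (path_image bd - {b, d}) = {} \<or> ?J \<inter> (path_image bd - {b, d}) = {}"
    using connectedD[OF con open_inside[OF cl(1)] open_inside[OF cl(2)]] dis by blast
  then consider "path_image bd - {b, d} \<subseteq> ?I" | "path_image bd - {b, d} \<subseteq> ?J" using sub by blast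
  then show False
  proof cases
    case 1
    \<comment> \<open>\<open>?I\<close> is bounded by the chord and the arc through
      \<open>b\<close>; hence \<open>d\<close> is neither on its boundary nor, as an outer point, in
      it.\<close>
    then have "d \<in> closure ?I" using arc_endpoint_closure[OF bd, of d] closure_mono by blast
    then have "d \<in> ?I \<or> d \<in> path_image c1 \<union> path_image ac"
      using closure_inside_subset[OF cl(1)] by blast
    moreover have "d \<notin> path_image c1 \<union> path_image ac"
      unfolding c1(4) using ends cyc(5,6) icr by blast
    moreover have "d \<notin> ?I"
      by (rule outer_not_inside[OF _ _ cl(1), of _ D]) (use outer D c1 in auto)
    ultimately show False by blast
  next
    case 2
    then have "b \<in> closure ?J" using arc_endpoint_closure[OF bd, of b] closure_mono by blast
    then have "b \<in> ?J \<or> b \<in> path_image c2 \<union> path_image ac"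
      using closure_inside_subset[OF cl(2)] by blast
    moreover have "b \<notin> path_image c2 \<union> path_image ac"
      unfolding c2(4) using ends cyc(5,6) icr by blast
    moreover have "b \<notin> ?J"
      by (rule outer_not_inside[OF _ _ cl(2), of _ D]) (use outer D c2 in auto)
    ultimately show False by blast
  qed
qed

section \<open>Forbidden configurations in outerplanar drawings\<close>

fun path_edges :: "'a list \<Rightarrow> 'a set set" where
  "path_edges (x # y # zs) = insert {x, y} (path_edges (y # zs))"
| "path_edges _ = {}"

lemma path_edges_subset: "e \<in> path_edges xs \<Longrightarrow> e \<subseteq> set xs"
  by (induction xs rule: path_edges.induct) auto

lemma Union_path_edges: "length xs \<ge> 2 \<Longrightarrow> \<Union> (path_edges xs) = set xs"
proof (induction xs rule: path_edges.induct)
  case (1 x y zs)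
  then show ?case by (cases zs) auto
qed auto

lemma path_edges_append:
  "xs \<noteq> [] \<Longrightarrow> ys \<noteq> [] \<Longrightarrow>
    path_edges (xs @ ys) = insert {last xs, hd ys} (path_edges xs \<union> path_edges ys)"
proof (induction xs rule: path_edges.induct)
  case ("2_2" v)
  then show ?case by (cases ys) auto
qed auto

lemma path_edges_rev: "path_edges (rev xs) = path_edges xs"
proof (induction xs rule: path_edges.induct)
  case (1 x y zs)
  have "path_edges (rev (x # y # zs)) = path_edges (rev (y # zs) @ [x])" by simp
  also have "\<dots> = insert {y, x} (path_edges (rev (y # zs)))"
    by (subst path_edges_append) (auto simp: last_rev)
  finally show ?case using 1 by (simp add: insert_commute)
qed auto

lemma ends_notin_path_edges:
  assumes "distinct (a # p @ [b])" "p \<noteq> []"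
  shows "{a, b} \<notin> path_edges (a # p @ [b])"
proof
  assume asm: "{a, b} \<in> path_edges (a # p @ [b])"
  obtain x p' where p: "p = x # p'" using assms(2) by (cases p) auto
  have "path_edges (a # p @ [b]) = insert {a, x} (path_edges (p @ [b]))" using p by simp
  moreover have "{a, b} \<noteq> {a, x}" using assms p by (auto simp: doubleton_eq_iff)
  ultimately have "{a, b} \<in> path_edges (p @ [b])" using asm by (metis insertE)
  from path_edges_subset[OF this] show False using assms by auto
qed

text \<open>Two vertices joined by an edge count as a cycle of length 2.\<close>

definition cycle :: "'a set set \<Rightarrow> 'a list \<Rightarrow> bool" where
  "cycle E xs \<longleftrightarrow> distinct xs \<and> length xs \<ge> 2 \<and> path_edges xs \<subseteq> E \<and> {last xs, hd xs} \<in> E"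

lemma cycle_append_commute:
  assumes "cycle E (xs @ ys)"
  shows "cycle E (ys @ xs)"
proof (cases "xs = [] \<or> ys = []")
  case False
  then show ?thesis using assms unfolding cycle_def
    by (auto simp: path_edges_append)
qed (use assms in auto)

text \<open>The configuration is a subdivision of the complete bipartite graph with parts of 2 and 3
  vertices. Each path must have an inner vertex, since a cycle with one chord is
  outerplanar.\<close>

definition theta_free :: "'a set set \<Rightarrow> bool" where
  "theta_free E \<longleftrightarrow> (\<forall>a b p q r. distinct (a # b # p @ q @ r) \<and> p \<noteq> [] \<and> q \<noteq> [] \<and> r \<noteq> [] \<longrightarrow>
     \<not> path_edges (a # p @ [b]) \<union> path_edges (a # q @ [b]) \<union> path_edges (a # r @ [b]) \<subseteq> E)"

text \<open>The configuration is a subdivision of the complete graph on four vertices whose two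
  chords are single edges. A chord with inner vertices would already form a theta with the two
  halves of the cycle.\<close>

definition cross_free :: "'a set set \<Rightarrow> bool" where
  "cross_free E \<longleftrightarrow> (\<forall>a b c d p q r s. cycle E (a # p @ b # q @ c # r @ d # s) \<longrightarrow>
     {a, c} \<notin> E \<or> {b, d} \<notin> E)"

lemma theta_free_mono: "theta_free E \<Longrightarrow> F \<subseteq> E \<Longrightarrow> theta_free F"
  unfolding theta_free_def by (meson subset_trans)

lemma cross_free_mono: "cross_free E \<Longrightarrow> F \<subseteq> E \<Longrightarrow> cross_free F"
  unfolding cross_free_def cycle_def by (meson subset_iff)

context
  fixes V :: "'a set" and E :: "'a set set" and pos :: "'a \<Rightarrow> complex" and \<gamma> :: "'a set \<Rightarrow> real \<Rightarrow> complex"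
  assumes graph: "simple_graph V E" and drawing: "plane_drawing V E pos \<gamma>"
begin

lemma edge_images_Int:
  assumes "A \<subseteq> E" "B \<subseteq> E" "A \<inter> B = {}"
  shows "(\<Union>e\<in>A. path_image (\<gamma> e)) \<inter> (\<Union>e\<in>B. path_image (\<gamma> e)) = pos ` (\<Union>A \<inter> \<Union>B)"
proof -
  have "path_image (\<gamma> e) \<inter> path_image (\<gamma> f) = pos ` (e \<inter> f)" if "e \<in> A" "f \<in> B" for e f
  proof -
    have "e \<in> E" "f \<in> E" "e \<noteq> f" using that assms by auto
    then show ?thesis using drawing unfolding plane_drawing_def by simp
  qed
  then have "(\<Union>e\<in>A. \<Union>f\<in>B. path_image (\<gamma> e) \<inter> path_image (\<gamma> f)) = (\<Union>e\<in>A. \<Union>f\<in>B. pos ` (e \<inter> f))"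
    by simp
  also have "\<dots> = pos ` (\<Union>A \<inter> \<Union>B)" by auto
  finally show ?thesis by auto
qed

lemma edge_arc:
  assumes "{x, y} \<in> E"
  obtains g where "arc g" "pathstart g = pos x" "pathfinish g = pos y" "path_image g = path_image (\<gamma> {x, y})"
proof -
  have a: "arc (\<gamma> {x, y})" and e: "{pathstart (\<gamma> {x, y}), pathfinish (\<gamma> {x, y})} = {pos x, pos y}"
    using drawing assms unfolding plane_drawing_def by auto
  from e consider "pathstart (\<gamma> {x, y}) = pos x" "pathfinish (\<gamma> {x, y}) = pos y"
    | "pathstart (\<gamma> {x, y}) = pos y" "pathfinish (\<gamma> {x, y}) = pos x"
    by (auto simp: doubleton_eq_iff)
  then show thesis
  proof cases
    case 1
    then show thesis using that a by blast
  next
    case 2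
    then show thesis using that[of "reversepath (\<gamma> {x, y})"] a by (simp add: arc_reversepath)
  qed
qed

lemma path_arc:
  assumes "distinct xs" "length xs \<ge> 2" "path_edges xs \<subseteq> E"
  shows "\<exists>g. arc g \<and> pathstart g = pos (hd xs) \<and> pathfinish g = pos (last xs)
    \<and> path_image g = (\<Union>e\<in>path_edges xs. path_image (\<gamma> e))"
  using assms
proof (induction xs rule: path_edges.induct)
  case (1 x y zs)
  obtain g0 where g0: "arc g0" "pathstart g0 = pos x" "pathfinish g0 = pos y"
    "path_image g0 = path_image (\<gamma> {x, y})"
    using edge_arc[of x y] 1 by auto
  show ?case
  proof (cases zs)
    case Nil
    then show ?thesis using g0 by auto
  next
    case (Cons z zs')
    then obtain g where g: "arc g" "pathstart g = pos y" "pathfinish g = pos (last (y # zs))"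
      "path_image g = (\<Union>e\<in>path_edges (y # zs). path_image (\<gamma> e))"
      using 1 by auto
    have "{x, y} \<notin> path_edges (y # zs)" using path_edges_subset[of "{x, y}" "y # zs"] 1 by auto
    moreover have "\<Union> (path_edges (y # zs)) = set (y # zs)"
      by (rule Union_path_edges) (simp add: Cons)
    moreover have "{x, y} \<inter> set (y # zs) = {y}" using 1 by auto
    ultimately have "path_image g0 \<inter> path_image g = {pos y}"
      using edge_images_Int[of "{{x, y}}" "path_edges (y # zs)"] 1 unfolding g0(4) g(4) by simp
    then have "arc (g0 +++ g)" using g0 g by (intro arc_join) auto
    then show ?thesis using g0 g by (intro exI[of _ "g0 +++ g"]) (simp add: path_image_join)
  qed
qed auto

lemma path_images_Int:
  assumes "length xs \<ge> 2" "length ys \<ge> 2" "path_edges xs \<subseteq> E" "path_edges ys \<subseteq> E"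
    "path_edges xs \<inter> path_edges ys = {}"
  shows "(\<Union>e\<in>path_edges xs. path_image (\<gamma> e)) \<inter> (\<Union>e\<in>path_edges ys. path_image (\<gamma> e))
    = pos ` (set xs \<inter> set ys)"
  using edge_images_Int[OF assms(3-5)] Union_path_edges assms by metis

lemma path_edges_disjoint:
  assumes "path_edges xs \<subseteq> E" "set xs \<inter> set ys \<subseteq> {z}"
  shows "path_edges xs \<inter> path_edges ys = {}"
proof -
  have False if "e \<in> path_edges xs" "e \<in> path_edges ys" for e
  proof -
    have "e \<subseteq> {z}" using path_edges_subset that assms by blast
    then have "card e \<le> 1" using card_mono[of "{z}" e] by simp
    moreover have "card e = 2" using graph that assms unfolding simple_graph_def by blast
    ultimately show False by simp
  qed
  then show ?thesis by blast
qed

lemma vertices_in_path_image: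
  assumes "length xs \<ge> 2" "path_edges xs \<subseteq> E" "x \<in> set xs"
  shows "pos x \<in> (\<Union>e\<in>path_edges xs. path_image (\<gamma> e))"
proof -
  obtain e where "e \<in> path_edges xs" "x \<in> e" using assms Union_path_edges by blast
  moreover have "pos ` e \<subseteq> path_image (\<gamma> e)" if "e \<in> E" for e
    using drawing that unfolding plane_drawing_def by blast
  ultimately show ?thesis using assms by blast
qed

lemma path_vertices: "path_edges xs \<subseteq> E \<Longrightarrow> length xs \<ge> 2 \<Longrightarrow> set xs \<subseteq> V"
  using Union_path_edges[of xs] graph unfolding simple_graph_def by blast

context
  assumes outer: "pos ` V \<subseteq> frontier (outside (drawing_image V E pos \<gamma>))"
begin

lemma theta_free_drawing: "theta_free E"
  unfolding theta_free_def
proof (intro allI impI notI, elim conjE)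
  fix a b p q r
  assume dis: "distinct (a # b # p @ q @ r)" and ne: "p \<noteq> []" "q \<noteq> []" "r \<noteq> []"
    and sub: "path_edges (a # p @ [b]) \<union> path_edges (a # q @ [b]) \<union> path_edges (a # r @ [b]) \<subseteq> E"
  let ?D = "drawing_image V E pos \<gamma>"
  let ?I = "\<lambda>p. (\<Union>e\<in>path_edges (a # p @ [b]). path_image (\<gamma> e))"
  have path: "\<exists>g. arc g \<and> pathstart g = pos a \<and> pathfinish g = pos b \<and> path_image g = ?I p"
    if "path_edges (a # p @ [b]) \<subseteq> E" "distinct (a # p @ [b])" for p
    using path_arc[of "a # p @ [b]"] that by auto
  have Int: "?I p \<inter> ?I q = {pos a, pos b}"
    if d: "distinct (a # b # p @ q)" "p \<noteq> []" and E: "path_edges (a # p @ [b]) \<subseteq> E" "path_edges (a # q @ [b]) \<subseteq> E" for p q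
  proof -
    have sets: "set (a # p @ [b]) \<inter> set (a # q @ [b]) = {a, b}" using d by auto
    \<comment> \<open>A common edge would have to be \<open>{a, b}\<close>, but a path from
      \<open>a\<close> to \<open>b\<close> with an inner vertex does not use it.\<close>
    have "path_edges (a # p @ [b]) \<inter> path_edges (a # q @ [b]) = {}"
    proof (rule ccontr)
      assume "\<not> ?thesis"
      then obtain e where e: "e \<in> path_edges (a # p @ [b])" "e \<in> path_edges (a # q @ [b])" by blast
      then have "e \<subseteq> {a, b}" using path_edges_subset sets by blast
      moreover have "card e = 2" using graph e E unfolding simple_graph_def by blast
      ultimately have "e = {a, b}" using d by (intro card_subset_eq) auto
      then show False using ends_notin_path_edges[of a p b] e d by auto
    qed
    from path_images_Int[OF _ _ E this] show ?thesis unfolding sets by simp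
  qed
  have inner: "\<exists>x. pos x \<in> ?I p - {pos a, pos b} \<and> x \<in> V"
    if d: "distinct (a # b # p)" "p \<noteq> []" and E: "path_edges (a # p @ [b]) \<subseteq> E" for p
  proof -
    have V: "set (a # p @ [b]) \<subseteq> V" using path_vertices[OF E] by simp
    have "hd p \<in> set p" using d by simp
    then have h: "hd p \<in> V" "a \<in> V" "b \<in> V" "hd p \<noteq> a" "hd p \<noteq> b" using V d by auto
    moreover have "inj_on pos V" using drawing unfolding plane_drawing_def by blast
    ultimately have "pos (hd p) \<notin> {pos a, pos b}" by (auto dest: inj_onD)
    moreover have "pos (hd p) \<in> ?I p"
      by (rule vertices_in_path_image[OF _ E]) (use d in auto)
    ultimately show ?thesis using h by blast
  qed
  have IE: "?I p \<subseteq> ?D" if "path_edges (a # p @ [b]) \<subseteq> E" for p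
    using that unfolding drawing_image_def by blast
  have E: "path_edges (a # p @ [b]) \<subseteq> E" "path_edges (a # q @ [b]) \<subseteq> E" "path_edges (a # r @ [b]) \<subseteq> E"
    using sub by blast+
  obtain g1 where g1: "arc g1" "pathstart g1 = pos a" "pathfinish g1 = pos b" "path_image g1 = ?I p"
    using path[OF E(1)] dis by auto
  obtain g2 where g2: "arc g2" "pathstart g2 = pos a" "pathfinish g2 = pos b" "path_image g2 = ?I q"
    using path[OF E(2)] dis by auto
  obtain g3 where g3: "arc g3" "pathstart g3 = pos a" "pathfinish g3 = pos b" "path_image g3 = ?I r"
    using path[OF E(3)] dis by auto
  obtain x where x: "pos x \<in> ?I p - {pos a, pos b}" "x \<in> V" using inner[of p] dis ne E by auto
  obtain y where y: "pos y \<in> ?I q - {pos a, pos b}" "y \<in> V" using inner[of q] dis ne E by auto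
  obtain z where z: "pos z \<in> ?I r - {pos a, pos b}" "z \<in> V" using inner[of r] dis ne E by auto
  have "?I p \<inter> ?I q = {pos a, pos b}" "?I p \<inter> ?I r = {pos a, pos b}" "?I q \<inter> ?I r = {pos a, pos b}"
    by (rule Int; use dis ne E in auto)+
  from no_outer_theta[OF g1(1-3) g2(1-3) g3(1-3), unfolded g1(4) g2(4) g3(4), OF this x(1) y(1) z(1)]
  have "\<not> (?I p \<union> ?I q \<union> ?I r \<subseteq> ?D) \<or> \<not> {pos x, pos y, pos z} \<subseteq> frontier (outside ?D)" by blast
  moreover have "?I p \<union> ?I q \<union> ?I r \<subseteq> ?D" using IE[OF E(1)] IE[OF E(2)] IE[OF E(3)] by blast
  ultimately show False using x(2) y(2) z(2) outer by blast
qed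

lemma cross_free_drawing: "cross_free E"
  unfolding cross_free_def
proof (intro allI impI, rule ccontr)
  fix a b c d p q r s
  assume cyc: "cycle E (a # p @ b # q @ c # r @ d # s)" and "\<not> ({a, c} \<notin> E \<or> {b, d} \<notin> E)"
  then have chords: "path_edges [a, c] \<subseteq> E" "path_edges [b, d] \<subseteq> E" by auto
  let ?D = "drawing_image V E pos \<gamma>"
  let ?I = "\<lambda>p. (\<Union>e\<in>path_edges p. path_image (\<gamma> e))"
  let ?ab = "a # p @ [b]" and ?bc = "b # q @ [c]" and ?cd = "c # r @ [d]" and ?da = "d # s @ [a]"
  have dis: "distinct (a # p @ b # q @ c # r @ d # s)" using cyc unfolding cycle_def by blast
  have cE: "path_edges (a # p @ b # q @ c # r @ d # s) \<subseteq> E" "{last (d # s), a} \<in> E"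
    using cyc unfolding cycle_def by auto
  have split: "path_edges (us @ v # ws) = path_edges (us @ [v]) \<union> path_edges (v # ws)" for us v and ws :: "'a list"
    by (cases "us = []"; cases "ws = []") (auto simp: path_edges_append)
  have "path_edges (a # p @ b # q @ c # r @ d # s)
     = path_edges ?ab \<union> path_edges ?bc \<union> path_edges ?cd \<union> path_edges (d # s)"
    using split[of "a # p" b "q @ c # r @ d # s"] split[of "b # q" c "r @ d # s"] split[of "c # r" d s]
    by auto
  moreover have "path_edges ?da = insert {last (d # s), a} (path_edges (d # s))"
    using path_edges_append[of "d # s" "[a]"] by simp
  ultimately have E: "path_edges ?ab \<subseteq> E" "path_edges ?bc \<subseteq> E" "path_edges ?cd \<subseteq> E" "path_edges ?da \<subseteq> E"
    using cE by auto
  have path: "\<exists>g. arc g \<and> pathstart g = pos x \<and> pathfinish g = pos y \<and> path_image g = ?I (x # p @ [y])"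
    if "path_edges (x # p @ [y]) \<subseteq> E" "distinct (x # p @ [y])" for p x y
    using path_arc[of "x # p @ [y]"] that by auto
  have Int1: "?I p \<inter> ?I q = {pos z}"
    if "set p \<inter> set q = {z}" "path_edges p \<subseteq> E" "path_edges q \<subseteq> E" "length p \<ge> 2" "length q \<ge> 2" for p q z
    using path_images_Int[OF that(4,5,2,3) path_edges_disjoint[OF that(2), of q z]] that(1) by simp
  have Int0: "?I p \<inter> ?I q = {}"
    if "set p \<inter> set q = {}" "path_edges p \<subseteq> E" "path_edges q \<subseteq> E" "length p \<ge> 2" "length q \<ge> 2" for p q
    using path_images_Int[OF that(4,5,2,3) path_edges_disjoint[OF that(2), of q]] that(1) by simp
  obtain ab where ab: "arc ab" "pathstart ab = pos a" "pathfinish ab = pos b" "path_image ab = ?I ?ab"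
    using path[OF E(1)] dis by auto
  obtain bc where bc: "arc bc" "pathstart bc = pos b" "pathfinish bc = pos c" "path_image bc = ?I ?bc"
    using path[OF E(2)] dis by auto
  obtain cd where cd: "arc cd" "pathstart cd = pos c" "pathfinish cd = pos d" "path_image cd = ?I ?cd"
    using path[OF E(3)] dis by auto
  obtain da where da: "arc da" "pathstart da = pos d" "pathfinish da = pos a" "path_image da = ?I ?da"
    using path[OF E(4)] dis by auto
  obtain ac where ac: "arc ac" "pathstart ac = pos a" "pathfinish ac = pos c" "path_image ac = ?I [a, c]"
    using path[of a "[]" c] chords dis by auto
  obtain bd where bd: "arc bd" "pathstart bd = pos b" "pathfinish bd = pos d" "path_image bd = ?I [b, d]"
    using path[of b "[]" d] chords dis by auto
  have sub: "?I ?ab \<union> ?I ?bc \<union> ?I ?cd \<union> ?I ?da \<union> ?I [a, c] \<union> ?I [b, d] \<subseteq> ?D"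
    using E chords unfolding drawing_image_def by blast
  have "{a, b, c, d} \<subseteq> V"
    using path_vertices[OF chords(1)] path_vertices[OF chords(2)] by simp
  then have out: "{pos a, pos b, pos c, pos d} \<subseteq> frontier (outside ?D)" using outer by blast
  \<comment> \<open>One fact for each of the 15 pairs among the four sides of the cycle and the two
    chords.\<close>
  have m1: "?I ?ab \<inter> ?I ?bc = {pos b}" by (rule Int1[OF _ E(1) E(2)]) (use dis in auto)
  have m2: "?I ?bc \<inter> ?I ?cd = {pos c}" by (rule Int1[OF _ E(2) E(3)]) (use dis in auto)
  have m3: "?I ?cd \<inter> ?I ?da = {pos d}" by (rule Int1[OF _ E(3) E(4)]) (use dis in auto)
  have m4: "?I ?da \<inter> ?I ?ab = {pos a}" by (rule Int1[OF _ E(4) E(1)]) (use dis in auto)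
  have m5: "?I ?ab \<inter> ?I ?cd = {}" by (rule Int0[OF _ E(1) E(3)]) (use dis in auto)
  have m6: "?I ?bc \<inter> ?I ?da = {}" by (rule Int0[OF _ E(2) E(4)]) (use dis in auto)
  have m7: "?I ?ab \<inter> ?I [a, c] = {pos a}" by (rule Int1[OF _ E(1) chords(1)]) (use dis in auto)
  have m8: "?I ?bc \<inter> ?I [a, c] = {pos c}" by (rule Int1[OF _ E(2) chords(1)]) (use dis in auto)
  have m9: "?I ?cd \<inter> ?I [a, c] = {pos c}" by (rule Int1[OF _ E(3) chords(1)]) (use dis in auto)
  have m10: "?I ?da \<inter> ?I [a, c] = {pos a}" by (rule Int1[OF _ E(4) chords(1)]) (use dis in auto)
  have m11: "?I ?ab \<inter> ?I [b, d] = {pos b}" by (rule Int1[OF _ E(1) chords(2)]) (use dis in auto)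
  have m12: "?I ?bc \<inter> ?I [b, d] = {pos b}" by (rule Int1[OF _ E(2) chords(2)]) (use dis in auto)
  have m13: "?I ?cd \<inter> ?I [b, d] = {pos d}" by (rule Int1[OF _ E(3) chords(2)]) (use dis in auto)
  have m14: "?I ?da \<inter> ?I [b, d] = {pos d}" by (rule Int1[OF _ E(4) chords(2)]) (use dis in auto)
  have m15: "?I [a, c] \<inter> ?I [b, d] = {}" by (rule Int0[OF _ chords(1) chords(2)]) (use dis in auto)
  show False
    by (rule no_outer_crossing_chords[OF ab(1-3) bc(1-3) cd(1-3) da(1-3) ac(1-3) bd(1-3),
          unfolded ab(4) bc(4) cd(4) da(4) ac(4) bd(4), OF m1 m2 m3 m4 m5 m6 m7 m8 m9 m10 m11 m12 m13 m14 m15 sub out])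
qed

end
end

lemma outerplanar_imp_free:
  assumes "simple_graph V E" "outerplanar V E"
  shows "theta_free E" "cross_free E"
proof -
  from assms(2) obtain pos \<gamma> where d: "plane_drawing V E pos \<gamma>"
    "pos ` V \<subseteq> frontier (outside (drawing_image V E pos \<gamma>))"
    unfolding outerplanar_def by blast
  show "theta_free E" by (rule theta_free_drawing[OF assms(1) d])
  show "cross_free E" by (rule cross_free_drawing[OF assms(1) d])
qed

section \<open>Noncrossing vertex orders\<close>

text \<open>Known as a one-page book embedding: all edges are drawn on one side of a line that
  carries the vertices, and alternating ends would force a crossing. The values of \<open>f\<close>
  are positions, possibly with gaps, not ranks.\<close>

definition noncrossing :: "('a \<Rightarrow> nat) \<Rightarrow> 'a set set \<Rightarrow> bool" where
  "noncrossing f E \<longleftrightarrow> (\<forall>a b c d. {a, c} \<in> E \<longrightarrow> {b, d} \<in> E \<longrightarrow> \<not> (f a < f b \<and> f b < f c \<and> f c < f d))"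

lemma noncrossingD:
  "noncrossing f E \<Longrightarrow> {a, c} \<in> E \<Longrightarrow> {b, d} \<in> E \<Longrightarrow> f a < f b \<Longrightarrow> f b < f c \<Longrightarrow> f c < f d \<Longrightarrow> False"
  unfolding noncrossing_def by blast

text \<open>Alternation of two pairs depends only on the cyclic order, so the order may be cut open
  at any \<open>z\<close>; the vertices before \<open>z\<close> move behind all others.\<close>

lemma noncrossing_rotate:
  assumes "finite V" "inj_on f V" "noncrossing f E" "\<And>e. e \<in> E \<Longrightarrow> e \<subseteq> V"
  obtains g :: "'a \<Rightarrow> nat" where "inj_on g V" "noncrossing g E" "g z = 0"
proof -
  obtain N where N: "\<And>v. v \<in> V \<Longrightarrow> f v < N"
    using finite_nat_set_iff_bounded[of "f ` V"] assms(1) by auto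
  define g where "g v = (if f v < f z then f v + N else f v - f z)" for v
  have g_less: "g u < g v \<longleftrightarrow> (if f u < f z then f v < f z \<and> f u < f v else f v < f z \<or> f u < f v)"
    if "u \<in> V" "v \<in> V" for u v
    using N[OF that(1)] N[OF that(2)] unfolding g_def by auto
  have "inj_on g V"
  proof (rule inj_onI)
    fix u v assume uv: "u \<in> V" "v \<in> V" "g u = g v"
    then have "f u = f v" using N[OF uv(1)] N[OF uv(2)] unfolding g_def by (auto split: if_splits)
    then show "u = v" using assms(2) uv by (auto dest: inj_onD)
  qed
  moreover have "noncrossing g E" unfolding noncrossing_def
  proof (intro allI impI notI)
    fix a b c d assume e: "{a, c} \<in> E" "{b, d} \<in> E" and l: "g a < g b \<and> g b < g c \<and> g c < g d"
    have "a \<in> V" "b \<in> V" "c \<in> V" "d \<in> V" using assms(4)[OF e(1)] assms(4)[OF e(2)] by auto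
    \<comment> \<open>The four cases are the cyclic shifts of the pattern \<open>a, b, c, d\<close>;
      each of them is an alternating pair for \<open>f\<close>.\<close>
    then have "(f a < f b \<and> f b < f c \<and> f c < f d) \<or> (f b < f c \<and> f c < f d \<and> f d < f a) \<or>
      (f c < f d \<and> f d < f a \<and> f a < f b) \<or> (f d < f a \<and> f a < f b \<and> f b < f c)"
      using l by (auto simp: g_less split: if_splits)
    moreover have "{c, a} \<in> E" "{d, b} \<in> E" using e by (auto simp: insert_commute)
    ultimately show False using e noncrossingD[OF assms(3)] by blast
  qed
  ultimately show thesis using that[of g] unfolding g_def by simp
qed

text \<open>Both orders are rotated to start at the common vertex; then the vertices of
  \<open>V2\<close> outside \<open>V1\<close> are placed behind all of \<open>V1\<close>. An edge of
  \<open>E2\<close> has both ends in the last block or starts at the very beginning, so it cannot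
  alternate with an edge of \<open>E1\<close>.\<close>

lemma noncrossing_glue:
  assumes V: "finite V1" "finite V2" "V1 \<inter> V2 \<subseteq> {z}"
    and f1: "inj_on f1 V1" "noncrossing f1 E1" and E1: "\<And>e. e \<in> E1 \<Longrightarrow> e \<subseteq> V1"
    and f2: "inj_on f2 V2" "noncrossing f2 E2" and E2: "\<And>e. e \<in> E2 \<Longrightarrow> e \<subseteq> V2"
  obtains f :: "'a \<Rightarrow> nat" where "inj_on f (V1 \<union> V2)" "noncrossing f (E1 \<union> E2)"
proof -
  obtain g1 where g1: "inj_on g1 V1" "noncrossing g1 E1" "g1 z = 0"
    using noncrossing_rotate[OF V(1) f1 E1] by metis
  obtain g2 where g2: "inj_on g2 V2" "noncrossing g2 E2" "g2 z = 0"
    using noncrossing_rotate[OF V(2) f2 E2] by metis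
  obtain N where N: "\<And>v. v \<in> V1 \<Longrightarrow> g1 v < N"
    using finite_nat_set_iff_bounded[of "g1 ` V1"] V(1) by auto
  define f where "f v = (if v \<in> V1 then g1 v else g2 v + N)" for v
  have common: "v \<in> V1 \<Longrightarrow> v \<in> V2 \<Longrightarrow> v = z" for v using V(3) by auto
  have mono2: "g2 u < g2 v" if "u \<in> V2" "v \<in> V2" "f u < f v" for u v
  proof (cases "u \<in> V1"; cases "v \<in> V1")
    assume "u \<in> V1" "v \<in> V1"
    then show ?thesis using that common by auto
  next
    assume u: "u \<in> V1" and v: "v \<notin> V1"
    then have "u = z" "v \<noteq> z" using common that by auto
    then have "g2 v \<noteq> g2 z" using g2(1) that by (auto dest: inj_onD)
    then show ?thesis using \<open>u = z\<close> g2(3) by simp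
  next
    assume u: "u \<notin> V1" and v: "v \<in> V1"
    then have "v = z" using common that by auto
    then show ?thesis using that u v g1(3) unfolding f_def by simp
  next
    assume "u \<notin> V1" "v \<notin> V1"
    then show ?thesis using that unfolding f_def by simp
  qed
  have mixed: "v = z" if "u \<in> V1" "v \<in> V2" "f v < f u" for u v
    using that common[of v] N[OF that(1)] unfolding f_def by (auto split: if_splits)
  have inj: "inj_on f (V1 \<union> V2)"
  proof (rule inj_onI)
    fix u v assume uv: "u \<in> V1 \<union> V2" "v \<in> V1 \<union> V2" "f u = f v"
    then have "(u \<in> V1 \<and> v \<in> V1 \<and> g1 u = g1 v) \<or> (u \<in> V2 \<and> v \<in> V2 \<and> g2 u = g2 v)"
      using N[of u] N[of v] unfolding f_def by (auto split: if_splits)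
    then show "u = v" using g1(1) g2(1) by (auto dest: inj_onD)
  qed
  have "noncrossing f (E1 \<union> E2)" unfolding noncrossing_def
  proof (intro allI impI notI)
    fix a b c d assume e: "{a, c} \<in> E1 \<union> E2" "{b, d} \<in> E1 \<union> E2" and l: "f a < f b \<and> f b < f c \<and> f c < f d"
    consider "{a, c} \<in> E1" "{b, d} \<in> E1" | "{a, c} \<in> E2" "{b, d} \<in> E2"
      | "{a, c} \<in> E1" "{b, d} \<in> E2" | "{a, c} \<in> E2" "{b, d} \<in> E1" using e by auto
    then show False
    proof cases
      case 1
      moreover have "a \<in> V1" "b \<in> V1" "c \<in> V1" "d \<in> V1" using E1[OF 1(1)] E1[OF 1(2)] by auto
      ultimately show False using l noncrossingD[OF g1(2), of a c b d] unfolding f_def by auto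
    next
      case 2
      moreover have "a \<in> V2" "b \<in> V2" "c \<in> V2" "d \<in> V2" using E2[OF 2(1)] E2[OF 2(2)] by auto
      ultimately show False using l mono2 noncrossingD[OF g2(2), of a c b d] by auto
    next
      case 3
      then have m: "a \<in> V1" "c \<in> V1" "b \<in> V2" using E1[OF 3(1)] E2[OF 3(2)] by auto
      then have "b = z" using mixed l by blast
      then have "f b = 0 \<or> f a < N \<and> f b \<ge> N \<and> f c < N" using m N g1(3) unfolding f_def by auto
      then show False using l by auto
    next
      case 4
      then have m: "a \<in> V2" "c \<in> V2" "d \<in> V1" using E2[OF 4(1)] E1[OF 4(2)] by auto
      then have "c = z" using mixed l by blast
      then have "f c = 0 \<or> f d < N \<and> f c \<ge> N" using m N g1(3) unfolding f_def by auto
      then show False using l by auto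
    qed
  qed
  then show thesis using inj that by blast
qed

section \<open>Longest cycles and separations\<close>

lemma rtrancl_imp_path:
  assumes "(x, y) \<in> r\<^sup>*" "y \<in> A" "\<And>u v. (u, v) \<in> r \<Longrightarrow> {u, v} \<in> E \<and> u \<in> A"
  shows "\<exists>p. p \<noteq> [] \<and> hd p = x \<and> last p = y \<and> distinct p \<and> path_edges p \<subseteq> E \<and> set p \<subseteq> A"
  using assms(1)
proof (induction rule: converse_rtrancl_induct)
  case base
  show ?case using assms(2) by (intro exI[of _ "[y]"]) auto
next
  case (step u v)
  then obtain p where p: "p \<noteq> []" "hd p = v" "last p = y" "distinct p" "path_edges p \<subseteq> E" "set p \<subseteq> A"
    by blast
  show ?case
  proof (cases "u \<in> set p")
    case True
    then obtain p1 p2 where s: "p = p1 @ u # p2" by (meson split_list)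
    have "path_edges (u # p2) \<subseteq> E" using p(5) s by (cases "p1 = []") (auto simp: path_edges_append)
    then show ?thesis using p s by (intro exI[of _ "u # p2"]) auto
  next
    case False
    obtain p' where "p = v # p'" using p by (cases p) auto
    then show ?thesis using p False assms(3)[OF step(1)] by (intro exI[of _ "u # p"]) auto
  qed
qed

text \<open>In a graph without a separation into two parts sharing at most one vertex, an ear on a longest
  cycle either attaches to adjacent vertices, and lengthens the cycle, or creates a theta.\<close>

lemma longest_cycle_Hamiltonian:
  assumes G: "simple_graph V E" "theta_free E"
    and nosep: "\<And>V1 V2 z. V1 \<union> V2 = V \<Longrightarrow> V1 \<inter> V2 \<subseteq> {z} \<Longrightarrow> V1 \<noteq> V \<Longrightarrow> V2 \<noteq> V \<Longrightarrow>
      \<exists>e\<in>E. \<not> e \<subseteq> V1 \<and> \<not> e \<subseteq> V2"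
    and cyc: "cycle E xs" and longest: "\<And>ys. cycle E ys \<Longrightarrow> length ys \<le> length xs"
  shows "set xs = V"
proof (rule ccontr)
  assume ne: "set xs \<noteq> V"
  have E: "e \<subseteq> V" "card e = 2" if "e \<in> E" for e using G(1) that unfolding simple_graph_def by auto
  have xsV: "set xs \<subseteq> V"
    using Union_path_edges[of xs] cyc E(1) unfolding cycle_def by blast
  then obtain v where v: "v \<in> V" "v \<notin> set xs" using ne by blast
  \<comment> \<open>\<open>D\<close> below is the component of \<open>v\<close> in the graph without
    the cycle; \<open>N\<close> consists of its neighbours on the cycle.\<close>
  define r where "r = {(u, w). {u, w} \<in> E \<and> u \<in> V - set xs \<and> w \<in> V - set xs}"
  define D where "D = r\<^sup>* `` {v}"
  have symr: "sym r" unfolding r_def sym_def by (auto simp: insert_commute)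
  have vD: "v \<in> D" unfolding D_def by auto
  have Dsub: "D \<subseteq> V - set xs"
  proof
    fix u assume "u \<in> D"
    then have "(v, u) \<in> r\<^sup>*" unfolding D_def by auto
    then show "u \<in> V - set xs" by (induction) (use v in \<open>auto simp: r_def\<close>)
  qed
  have Dclosed: "w \<in> D" if "u \<in> D" "{u, w} \<in> E" "w \<notin> set xs" for u w
  proof -
    have "(u, w) \<in> r" using that Dsub E(1)[OF that(2)] unfolding r_def by auto
    then show ?thesis using that(1) unfolding D_def by auto
  qed
  define N where "N = {c \<in> set xs. \<exists>d\<in>D. {c, d} \<in> E}"
  have "\<exists>a b. a \<in> N \<and> b \<in> N \<and> a \<noteq> b"
  proof (rule ccontr)
    assume no: "\<not> ?thesis"
    obtain z where z: "N \<subseteq> {z}" using no by blast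
    have len: "card (set xs) \<ge> 2" using cyc unfolding cycle_def by (simp add: distinct_card)
    have "set xs \<noteq> N" using card_mono[OF _ z] len by auto
    then obtain w where w: "w \<in> set xs" "w \<notin> N" unfolding N_def by blast
    \<comment> \<open>With at most one attachment vertex, \<open>D \<union> N\<close> and
      \<open>V - D\<close> would be a separation; \<open>nosep\<close> then yields an edge from
      \<open>D\<close> to a vertex beyond \<open>N\<close>.\<close>
    have "\<exists>e\<in>E. \<not> e \<subseteq> D \<union> N \<and> \<not> e \<subseteq> V - D"
    proof (rule nosep)
      show "(D \<union> N) \<union> (V - D) = V" using Dsub xsV unfolding N_def by auto
      show "(D \<union> N) \<inter> (V - D) \<subseteq> {z}" using z by auto
      show "D \<union> N \<noteq> V" using w xsV Dsub by auto
      show "V - D \<noteq> V" using vD v by auto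
    qed
    then obtain e where e: "e \<in> E" "\<not> e \<subseteq> D \<union> N" "\<not> e \<subseteq> V - D" by blast
    obtain x y where xy: "e = {x, y}" using E(2)[OF e(1)] by (meson card_2_iff)
    have "x \<in> D \<or> y \<in> D" using e xy E(1)[OF e(1)] by auto
    then obtain u w where uw: "e = {u, w}" "u \<in> D" using xy by (metis insert_commute)
    then have "w \<notin> D" using e by auto
    then have "w \<in> set xs" using Dclosed uw e(1) by blast
    then have "w \<in> N" unfolding N_def using uw e(1) by (auto simp: insert_commute)
    then show False using e uw by auto
  qed
  then obtain a b where ab: "a \<in> N" "b \<in> N" "a \<noteq> b" by blast
  obtain x where x: "x \<in> D" "{a, x} \<in> E" using ab unfolding N_def by auto
  obtain y where y: "y \<in> D" "{b, y} \<in> E" using ab unfolding N_def by auto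
  have "(x, v) \<in> r\<^sup>*" using x symr unfolding D_def by (metis Image_singleton_iff sym_rtrancl symD)
  then have xy: "(x, y) \<in> r\<^sup>*" using y unfolding D_def by auto
  have "y \<in> V - set xs" using y Dsub by blast
  moreover have "{u, w} \<in> E \<and> u \<in> V - set xs" if "(u, w) \<in> r" for u w using that unfolding r_def by auto
  ultimately obtain p where p: "p \<noteq> []" "hd p = x" "last p = y" "distinct p" "path_edges p \<subseteq> E" "set p \<subseteq> V - set xs"
    using rtrancl_imp_path[OF xy, of "V - set xs" E] by blast
  \<comment> \<open>The cycle is rotated to start at \<open>a\<close>; \<open>p1\<close> and
    \<open>p2\<close> are its two stretches between \<open>a\<close> and \<open>b\<close>.\<close>
  obtain l1 l2 where l: "xs = l1 @ a # l2" using ab unfolding N_def by (auto dest: split_list)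
  then have cyc': "cycle E (a # l2 @ l1)" using cyc cycle_append_commute[of E l1 "a # l2"] by simp
  have set': "set (a # l2 @ l1) = set xs" "length (a # l2 @ l1) = length xs" using l by auto
  have "b \<in> set (l2 @ l1)" using ab set' unfolding N_def by auto
  then obtain p1 p2 where l21: "l2 @ l1 = p1 @ b # p2" by (meson split_list)
  have c: "cycle E (a # p1 @ b # p2)" using cyc' l21 by simp
  have st: "set xs = set (a # p1 @ b # p2)" "length xs = length (a # p1 @ b # p2)" using set' l21 by auto
  have dis: "distinct (a # p1 @ b # p2)" using c unfolding cycle_def by blast
  have ext: "cycle E (zs @ q)" if "cycle E zs" "q \<noteq> []" "distinct q" "path_edges q \<subseteq> E" "set q \<inter> set zs = {}"
    "{last zs, hd q} \<in> E" "{last q, hd zs} \<in> E" for zs q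
  proof -
    have "zs \<noteq> []" using that(1) unfolding cycle_def by auto
    then show ?thesis using that unfolding cycle_def by (auto simp: path_edges_append)
  qed
  \<comment> \<open>If \<open>a\<close> and \<open>b\<close> were consecutive, the path through
    \<open>D\<close> could be inserted between them, giving a longer cycle; \<open>p2\<close> is
    treated alike.\<close>
  have "p1 \<noteq> []"
  proof
    assume "p1 = []"
    then have "cycle E (b # p2 @ [a])"
      using cycle_append_commute[of E "[a]" "b # p2"] c by simp
    moreover have "set p \<inter> set (b # p2 @ [a]) = {}" using p(6) st(1) by auto
    ultimately have "cycle E ((b # p2 @ [a]) @ p)"
      using p x y by (intro ext) (simp_all add: insert_commute)
    from longest[OF this] show False using st(2) p(1) \<open>p1 = []\<close> by simp
  qed
  moreover have "p2 \<noteq> []"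
  proof
    assume "p2 = []"
    then have "cycle E (a # p1 @ [b])" using c by simp
    moreover have "set (rev p) \<inter> set (a # p1 @ [b]) = {}" using p(6) st(1) by auto
    ultimately have "cycle E ((a # p1 @ [b]) @ rev p)"
      using p x y by (intro ext) (simp_all add: insert_commute path_edges_rev hd_rev last_rev)
    from longest[OF this] show False using st(2) p(1) \<open>p2 = []\<close> by simp
  qed
  moreover have "path_edges (a # p1 @ [b]) \<subseteq> E" "path_edges (b # p2 @ [a]) \<subseteq> E"
  proof -
    have "path_edges ((a # p1) @ (b # p2)) \<subseteq> E" "{last (b # p2), a} \<in> E"
      using c unfolding cycle_def by auto
    then show "path_edges (a # p1 @ [b]) \<subseteq> E" "path_edges (b # p2 @ [a]) \<subseteq> E"
      using path_edges_append[of "a # p1" "[b]"] path_edges_append[of "b # p2" "[a]"]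
        path_edges_append[of "a # p1" "b # p2"] by auto
  qed
  moreover have "path_edges (a # rev p2 @ [b]) = path_edges (b # p2 @ [a])"
    using path_edges_rev[of "b # p2 @ [a]"] by simp
  moreover have "path_edges (a # p @ [b]) \<subseteq> E"
  proof -
    have "path_edges (a # p) \<subseteq> E" using p x by (cases p) auto
    then show ?thesis using path_edges_append[of "a # p" "[b]"] p y by (auto simp: insert_commute)
  qed
  moreover have "distinct (a # b # p1 @ rev p2 @ p)" using dis p st by auto
  ultimately show False
    using G(2)[unfolded theta_free_def, rule_format, of a b p1 "rev p2" p] p(1) by auto
qed

lemma Hamiltonian_imp_noncrossing:
  assumes "cycle E xs" "cross_free E" "\<And>e. e \<in> E \<Longrightarrow> e \<subseteq> set xs"
  obtains f :: "'a \<Rightarrow> nat" where "inj_on f (set xs)" "noncrossing f E"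
proof -
  have dis: "distinct xs" using assms(1) unfolding cycle_def by blast
  define f where "f v = (THE i. i < length xs \<and> xs ! i = v)" for v
  have f: "f (xs ! i) = i" if "i < length xs" for i
    unfolding f_def using that dis by (auto simp: nth_eq_iff_index_eq)
  have "inj_on f (set xs)"
    by (rule inj_onI) (auto simp: in_set_conv_nth f)
  moreover have "noncrossing f E" unfolding noncrossing_def
  proof (intro allI impI notI)
    fix a b c d assume e: "{a, c} \<in> E" "{b, d} \<in> E" and l: "f a < f b \<and> f b < f c \<and> f c < f d"
    have "a \<in> set xs" "b \<in> set xs" "c \<in> set xs" "d \<in> set xs" using assms(3)[OF e(1)] assms(3)[OF e(2)] by auto
    then obtain i j k m where ij: "a = xs ! i" "b = xs ! j" "c = xs ! k" "d = xs ! m" "i < length xs" "j < length xs"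
      "k < length xs" "m < length xs" by (metis in_set_conv_nth)
    then have o: "i < j" "j < k" "k < m" using l f by auto
    have cut: "drop i xs = xs ! i # take (j - Suc i) (drop (Suc i) xs) @ drop j xs" if "i < j" "j < length xs" for i j
    proof -
      have "drop i xs = xs ! i # drop (Suc i) xs" using that by (simp add: Cons_nth_drop_Suc)
      moreover have "drop (Suc i) xs = take (j - Suc i) (drop (Suc i) xs) @ drop j xs"
        using append_take_drop_id[of "j - Suc i" "drop (Suc i) xs"] that by simp
      ultimately show ?thesis by simp
    qed
    obtain p where p: "drop i xs = a # p @ drop j xs" using cut[of i j] o ij by blast
    obtain q where q: "drop j xs = b # q @ drop k xs" using cut[of j k] o ij by blast
    obtain r where r: "drop k xs = c # r @ drop m xs" using cut[of k m] o ij by blast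
    obtain s where s: "drop m xs = d # s" using ij by (metis Cons_nth_drop_Suc)
    have "xs = take i xs @ a # p @ b # q @ c # r @ d # s"
      using append_take_drop_id[of i xs] p q r s by simp
    then have "cycle E (a # p @ b # q @ c # r @ d # (s @ take i xs))"
      using cycle_append_commute[of E "take i xs" "drop i xs"] assms(1) p q r s by simp
    then show False using assms(2) e unfolding cross_free_def by blast
  qed
  ultimately show thesis using that by blast
qed

theorem free_imp_noncrossing:
  assumes "simple_graph V E" "theta_free E" "cross_free E"
  shows "\<exists>f :: 'a \<Rightarrow> nat. inj_on f V \<and> noncrossing f E"
  using assms
proof (induction "card V" arbitrary: V E rule: less_induct)
  case less
  have E: "e \<subseteq> V" "card e = 2" if "e \<in> E" for e
    using less.prems(1) that unfolding simple_graph_def by auto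
  have fin: "finite V" using less.prems(1) unfolding simple_graph_def by auto
  define separation where "separation V1 V2 z \<longleftrightarrow> V1 \<union> V2 = V \<and> V1 \<inter> V2 \<subseteq> {z} \<and> V1 \<noteq> V \<and> V2 \<noteq> V
    \<and> (\<forall>e\<in>E. e \<subseteq> V1 \<or> e \<subseteq> V2)" for V1 V2 z
  show ?case
  proof (cases "\<exists>V1 V2 z. separation V1 V2 z")
    case True
    then obtain V1 V2 z where "separation V1 V2 z" by blast
    then have s: "V1 \<union> V2 = V" "V1 \<inter> V2 \<subseteq> {z}" "V1 \<noteq> V" "V2 \<noteq> V"
      "\<forall>e\<in>E. e \<subseteq> V1 \<or> e \<subseteq> V2" unfolding separation_def by simp_all
    have sub: "\<exists>f :: 'a \<Rightarrow> nat. inj_on f W \<and> noncrossing f {e \<in> E. e \<subseteq> W}" if "W \<subset> V" for W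
    proof (rule less.hyps)
      show "card W < card V" using fin that by (simp add: psubset_card_mono)
      show "simple_graph W {e \<in> E. e \<subseteq> W}" using fin that E(2) unfolding simple_graph_def
        by (auto intro: finite_subset)
      show "theta_free {e \<in> E. e \<subseteq> W}" by (rule theta_free_mono[OF less.prems(2)]) auto
      show "cross_free {e \<in> E. e \<subseteq> W}" by (rule cross_free_mono[OF less.prems(3)]) auto
    qed
    obtain f1 :: "'a \<Rightarrow> nat" where f1: "inj_on f1 V1" "noncrossing f1 {e \<in> E. e \<subseteq> V1}" using sub[of V1] s by blast
    obtain f2 :: "'a \<Rightarrow> nat" where f2: "inj_on f2 V2" "noncrossing f2 {e \<in> E. e \<subseteq> V2}" using sub[of V2] s by blast
    have "finite V1" "finite V2" using fin s by auto
    then obtain f :: "'a \<Rightarrow> nat" where f: "inj_on f (V1 \<union> V2)" "noncrossing f ({e \<in> E. e \<subseteq> V1} \<union> {e \<in> E. e \<subseteq> V2})"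
      using noncrossing_glue[OF _ _ s(2) f1 _ f2] by blast
    moreover have "{e \<in> E. e \<subseteq> V1} \<union> {e \<in> E. e \<subseteq> V2} = E" using s(5) by auto
    ultimately show ?thesis using s(1) by auto
  next
    case False
    then have nosep: "\<exists>e\<in>E. \<not> e \<subseteq> V1 \<and> \<not> e \<subseteq> V2"
      if "V1 \<union> V2 = V" "V1 \<inter> V2 \<subseteq> {z}" "V1 \<noteq> V" "V2 \<noteq> V" for V1 V2 z
      using that unfolding separation_def by metis
    show ?thesis
    proof (cases "E = {}")
      case True
      obtain f :: "'a \<Rightarrow> nat" where "inj_on f V" using finite_imp_inj_to_nat_seg[OF fin] by blast
      then show ?thesis using True unfolding noncrossing_def by auto
    next
      case False
      then obtain e where "e \<in> E" by blast
      then obtain a b where ab: "e = {a, b}" "a \<noteq> b" using E(2) by (meson card_2_iff)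
      \<comment> \<open>Since an edge counts as a cycle, a longest cycle exists as soon as there is
        an edge; this covers the graph with two vertices and one edge.\<close>
      then have "cycle E [a, b]" using \<open>e \<in> E\<close> unfolding cycle_def by (auto simp: insert_commute)
      moreover have bound: "length ys \<le> card V" if "cycle E ys" for ys
      proof -
        have "set ys \<subseteq> V" using Union_path_edges[of ys] that E(1) unfolding cycle_def by blast
        then have "card (set ys) \<le> card V" using fin card_mono by blast
        moreover have "card (set ys) = length ys" using that unfolding cycle_def by (simp add: distinct_card)
        ultimately show ?thesis by simp
      qed
      ultimately have "\<exists>xs. cycle E xs \<and> (\<forall>ys. cycle E ys \<longrightarrow> length ys \<le> length xs)"
        by (intro ex_has_greatest_nat[of _ "[a, b]" _ "Suc (card V)"]) (auto simp: less_Suc_eq_le)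
      then obtain xs where xs: "cycle E xs" "\<And>ys. cycle E ys \<Longrightarrow> length ys \<le> length xs" by metis
      have "set xs = V"
        by (rule longest_cycle_Hamiltonian[OF less.prems(1,2) nosep xs])
      with Hamiltonian_imp_noncrossing[OF xs(1) less.prems(3)] E(1) show ?thesis by metis
    qed
  qed
qed

section \<open>Drawing on a parabola and counting edges\<close>

definition parabola :: "nat \<Rightarrow> complex" where
  "parabola i = Complex (real i) ((real i)\<^sup>2)"

lemma inj_parabola: "inj parabola"
  by (rule injI) (simp add: parabola_def)

text \<open>Affine function vanishing on the line through \<open>parabola i\<close> and \<open>parabola j\<close>; on the parabola it
  is \<open>(t - i) (t - j)\<close>.\<close>

definition chord_form :: "nat \<Rightarrow> nat \<Rightarrow> complex \<Rightarrow> real" where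
  "chord_form i j z = Im z - (real i + real j) * Re z + real i * real j"

lemma chord_form_parabola: "chord_form i j (parabola t) = (real t - real i) * (real t - real j)"
  by (simp add: chord_form_def parabola_def power2_eq_square algebra_simps)

lemma chord_form_convex:
  "chord_form i j ((1 - u) *\<^sub>R x + u *\<^sub>R y) = (1 - u) * chord_form i j x + u * chord_form i j y"
  by (simp add: chord_form_def algebra_simps)

lemma chord_form_segment:
  assumes "z \<in> closed_segment (parabola i) (parabola j)"
  shows "chord_form i j z = 0"
  using assms by (auto simp: in_segment chord_form_convex chord_form_parabola)

lemma parabola_in_segment:
  assumes "parabola t \<in> closed_segment (parabola i) (parabola j)"
  shows "t \<in> {i, j}"
  using chord_form_segment[OF assms] by (simp add: chord_form_parabola)

lemma convex_combination_same_sign: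
  fixes u x y :: real
  assumes "0 \<le> u" "u \<le> 1" "0 \<le> x * y" "(1 - u) * x + u * y = 0"
  shows "(u = 0 \<or> y = 0) \<and> (u = 1 \<or> x = 0)"
proof -
  have "((1 - u) * x) * (u * y) \<ge> 0"
    using assms(1-3) by (metis mult.assoc mult.left_commute mult_nonneg_nonneg diff_ge_0_iff_ge)
  moreover have "(1 - u) * x = - (u * y)" using assms(4) by simp
  ultimately have "(u * y) * (u * y) \<le> 0" by simp
  then have "u * y = 0" by (metis mult_eq_0_iff not_square_less_zero order_le_less zero_le_square antisym)
  then show ?thesis using \<open>(1 - u) * x = - (u * y)\<close> by auto
qed

text \<open>The ends of the second chord lie weakly on the same side of the line through the first.
  Hence the affine \<open>chord_form\<close> can vanish on the second chord only at an end on that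
  line, and the line meets the parabola only in the ends of the first chord.\<close>

lemma chords_Int:
  assumes "i < j" "k < l" "{i, j} \<noteq> {k, l}" "\<not> (i < k \<and> k < j \<and> j < l)" "\<not> (k < i \<and> i < l \<and> l < j)"
    and z: "z \<in> closed_segment (parabola i) (parabola j)" "z \<in> closed_segment (parabola k) (parabola l)"
  shows "z \<in> parabola ` ({i, j} \<inter> {k, l})"
proof -
  obtain u where u: "0 \<le> u" "u \<le> 1" "z = (1 - u) *\<^sub>R parabola k + u *\<^sub>R parabola l"
    using z(2) by (auto simp: in_segment)
  let ?x = "(real k - real i) * (real k - real j)" and ?y = "(real l - real i) * (real l - real j)"
  have "(1 - u) * ?x + u * ?y = 0"
    using chord_form_segment[OF z(1)] unfolding u(3) by (simp add: chord_form_convex chord_form_parabola)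
  moreover have "0 \<le> ?x * ?y"
  proof -
    have "(i \<le> k \<and> k \<le> j \<and> i \<le> l \<and> l \<le> j) \<or> ((k \<le> i \<or> j \<le> k) \<and> (l \<le> i \<or> j \<le> l))"
      using assms(1-5) by linarith
    then have "(?x \<le> 0 \<and> ?y \<le> 0) \<or> (0 \<le> ?x \<and> 0 \<le> ?y)"
    proof
      assume "i \<le> k \<and> k \<le> j \<and> i \<le> l \<and> l \<le> j"
      then show ?thesis by (auto intro!: mult_nonneg_nonpos)
    next
      assume "(k \<le> i \<or> j \<le> k) \<and> (l \<le> i \<or> j \<le> l)"
      then have "0 \<le> ?x" "0 \<le> ?y" using assms(1)
        by (auto intro: mult_nonneg_nonneg mult_nonpos_nonpos)
      then show ?thesis by blast
    qed
    then show ?thesis by (auto intro: mult_nonneg_nonneg mult_nonpos_nonpos)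
  qed
  ultimately have "(u = 0 \<or> ?y = 0) \<and> (u = 1 \<or> ?x = 0)"
    using convex_combination_same_sign u by blast
  then have "(u = 0 \<or> l \<in> {i, j}) \<and> (u = 1 \<or> k \<in> {i, j})" by auto
  moreover have "\<not> (l \<in> {i, j} \<and> k \<in> {i, j})" using assms(1-3) by auto
  ultimately show ?thesis using u by auto
qed

text \<open>Straight edges stay in the convex region on and above the parabola, so everything below
  it belongs to the outer face and every vertex is approached from below.\<close>

lemma noncrossing_imp_outerplanar:
  assumes G: "simple_graph V E" and f: "inj_on f V" "noncrossing f E"
  shows "outerplanar V E"
proof -
  define pos where "pos = (\<lambda>v. parabola (f v))"
  \<comment> \<open>\<open>Min\<close> and \<open>Max\<close> choose a direction for the unordered
    edge \<open>e\<close>.\<close>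
  define \<gamma> where "\<gamma> e = linepath (parabola (Min (f ` e))) (parabola (Max (f ` e)))" for e
  have E: "\<exists>x y. e = {x, y} \<and> x \<in> V \<and> y \<in> V \<and> f x < f y" if "e \<in> E" for e
  proof -
    have "card e = 2" "e \<subseteq> V" using G that unfolding simple_graph_def by auto
    then obtain x y where "e = {x, y}" "x \<noteq> y" by (meson card_2_iff)
    moreover from this have "f x \<noteq> f y" using f(1) \<open>e \<subseteq> V\<close> by (auto dest: inj_onD)
    ultimately show ?thesis using \<open>e \<subseteq> V\<close> by (metis insert_commute insert_subset linorder_neqE_nat)
  qed
  have \<gamma>: "\<gamma> {x, y} = linepath (pos x) (pos y)" if "f x < f y" for x y
    using that unfolding \<gamma>_def pos_def by (simp add: max_def min_def)
  have injpos: "inj_on pos V" unfolding pos_def using f(1) inj_parabola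
    by (auto simp: inj_on_def)
  have edge: "arc (\<gamma> e) \<and> {pathstart (\<gamma> e), pathfinish (\<gamma> e)} = pos ` e \<and> path_image (\<gamma> e) \<inter> pos ` V = pos ` e"
    if e: "e \<in> E" for e
  proof -
    obtain x y where xy: "e = {x, y}" "x \<in> V" "y \<in> V" "f x < f y" using E[OF e] by blast
    have "pos x \<noteq> pos y" using xy injpos by (metis inj_onD less_irrefl)
    moreover have "v \<in> {x, y}" if "v \<in> V" "pos v \<in> closed_segment (pos x) (pos y)" for v
      using parabola_in_segment that xy f(1) unfolding pos_def by (auto dest: inj_onD)
    ultimately show ?thesis using xy by (auto simp: \<gamma>[OF xy(4)] arc_linepath)
  qed
  have meet: "path_image (\<gamma> e) \<inter> path_image (\<gamma> e') = pos ` (e \<inter> e')" if e: "e \<in> E" "e' \<in> E" "e \<noteq> e'" for e e'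
  proof
    obtain x y where xy: "e = {x, y}" "x \<in> V" "y \<in> V" "f x < f y" using E[OF e(1)] by blast
    obtain x' y' where xy': "e' = {x', y'}" "x' \<in> V" "y' \<in> V" "f x' < f y'" using E[OF e(2)] by blast
    show "pos ` (e \<inter> e') \<subseteq> path_image (\<gamma> e) \<inter> path_image (\<gamma> e')"
      using edge[OF e(1)] edge[OF e(2)] by blast
    show "path_image (\<gamma> e) \<inter> path_image (\<gamma> e') \<subseteq> pos ` (e \<inter> e')"
    proof
      fix z assume "z \<in> path_image (\<gamma> e) \<inter> path_image (\<gamma> e')"
      then have z: "z \<in> closed_segment (parabola (f x)) (parabola (f y))"
        "z \<in> closed_segment (parabola (f x')) (parabola (f y'))"
        unfolding xy(1) xy'(1) \<gamma>[OF xy(4)] \<gamma>[OF xy'(4)] pos_def by auto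
      have "f ` e \<noteq> f ` e'"
        using e(3) f(1) xy xy' by (metis (no_types, lifting) empty_subsetI insert_subset inj_on_image_eq_iff)
      then have ne: "{f x, f y} \<noteq> {f x', f y'}" unfolding xy xy' by simp
      have "z \<in> parabola ` ({f x, f y} \<inter> {f x', f y'})"
        using noncrossingD[OF f(2), of x y x' y'] noncrossingD[OF f(2), of x' y' x y] e xy xy'
        by (intro chords_Int[OF xy(4) xy'(4) ne _ _ z]) auto
      moreover have "{f x, f y} \<inter> {f x', f y'} = f ` (e \<inter> e')"
        using inj_on_image_Int[OF f(1), of e e'] xy xy' by simp
      ultimately show "z \<in> pos ` (e \<inter> e')" unfolding pos_def by auto
    qed
  qed
  have pd: "plane_drawing V E pos \<gamma>"
    unfolding plane_drawing_def using injpos edge meet by simp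
  let ?D = "drawing_image V E pos \<gamma>"
  define K where "K = {z. (Re z)\<^sup>2 \<le> Im z}"
  have "convex K"
  proof (rule convexI)
    fix x y :: complex and u v :: real
    assume h: "x \<in> K" "y \<in> K" "0 \<le> u" "0 \<le> v" "u + v = 1"
    have "(u * Re x + v * Re y)\<^sup>2 \<le> u * (Re x)\<^sup>2 + v * (Re y)\<^sup>2"
    proof -
      have "u * (Re x)\<^sup>2 + v * (Re y)\<^sup>2 - (u * Re x + v * Re y)\<^sup>2 = u * v * (Re x - Re y)\<^sup>2"
      proof -
        have v: "v = 1 - u" using h by simp
        show ?thesis unfolding v by (simp add: power2_eq_square algebra_simps)
      qed
      moreover have "u * v * (Re x - Re y)\<^sup>2 \<ge> 0" using h by simp
      ultimately show ?thesis by linarith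
    qed
    also have "\<dots> \<le> u * Im x + v * Im y"
      using h unfolding K_def by (auto intro!: add_mono mult_left_mono)
    finally show "u *\<^sub>R x + v *\<^sub>R y \<in> K" unfolding K_def by simp
  qed
  have posK: "pos v \<in> K" for v unfolding K_def pos_def parabola_def by simp
  have "path_image (\<gamma> e) \<subseteq> K" if e: "e \<in> E" for e
  proof -
    obtain x y where xy: "e = {x, y}" "x \<in> V" "y \<in> V" "f x < f y" using E[OF e] by blast
    then show ?thesis using closed_segment_subset[OF posK posK \<open>convex K\<close>] by (simp add: \<gamma>)
  qed
  then have "?D \<subseteq> K" using posK unfolding drawing_image_def by auto
  then have out: "- K \<subseteq> outside ?D" using outside_subset_convex[OF \<open>convex K\<close>] by blast
  have "pos v \<in> frontier (outside ?D)" if "v \<in> V" for v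
  proof -
    have "pos v \<in> closure (outside ?D)"
    proof (unfold closure_approachable, intro allI impI)
      fix e :: real assume "e > 0"
      let ?y = "pos v - Complex 0 (e / 2)"
      have "?y \<in> - K" using \<open>e > 0\<close> unfolding K_def pos_def parabola_def by simp
      moreover have "dist ?y (pos v) < e" using \<open>e > 0\<close> by (simp add: dist_norm cmod_def)
      ultimately show "\<exists>y\<in>outside ?D. dist y (pos v) < e" using out by blast
    qed
    moreover have "pos v \<notin> interior (outside ?D)"
    proof -
      have "pos v \<in> ?D" using that unfolding drawing_image_def by blast
      then have "pos v \<notin> outside ?D" unfolding outside_def by blast
      then show ?thesis using interior_subset by blast
    qed
    ultimately show ?thesis unfolding frontier_def by blast
  qed
  then show ?thesis unfolding outerplanar_def using pd by blast
qed

theorem outerplanar_iff_noncrossing: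
  assumes "simple_graph V E"
  shows "outerplanar V E \<longleftrightarrow> (\<exists>f :: 'a \<Rightarrow> nat. inj_on f V \<and> noncrossing f E)"
  using free_imp_noncrossing[OF assms] outerplanar_imp_free[OF assms] noncrossing_imp_outerplanar[OF assms]
  by blast

section \<open>Edge count of noncrossing graphs\<close>

lemma noncrossing_card_nat:
  fixes S :: "nat set"
  assumes "finite S" "card S \<ge> 2" "\<And>e. e \<in> E \<Longrightarrow> e \<subseteq> S \<and> card e = 2" "noncrossing id E"
  shows "card E + 3 \<le> 2 * card S"
  using assms
proof (induction "card S" arbitrary: S E rule: less_induct)
  case less
  define a b where "a = Min S" and "b = Max S"
  have Sne: "S \<noteq> {}" using less.prems(2) by auto
  have a: "a \<in> S" "\<And>x. x \<in> S \<Longrightarrow> a \<le> x" and b: "b \<in> S" "\<And>x. x \<in> S \<Longrightarrow> x \<le> b"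
    using less.prems(1) Sne unfolding a_def b_def by auto
  have finE: "finite E" using less.prems(1,3) by (meson finite_Pow_iff finite_subset PowI subsetI)
  have edge: "\<exists>x y. e = {x, y} \<and> x < y \<and> x \<in> S \<and> y \<in> S" if e: "e \<in> E" for e
  proof -
    obtain x y where "e = {x, y}" "x \<noteq> y" using less.prems(3)[OF e] by (meson card_2_iff)
    then show ?thesis using less.prems(3)[OF e] by (metis insert_commute insert_subset linorder_neqE_nat)
  qed
  have IH: "card {e \<in> E. e \<subseteq> T} + 3 \<le> 2 * card T" if "T \<subset> S" "card T \<ge> 2" for T
  proof (rule less.hyps)
    show "card T < card S" using that less.prems(1) by (simp add: psubset_card_mono)
    show "finite T" using that less.prems(1) by (meson finite_subset psubset_imp_subset)
    show "noncrossing id {e \<in> E. e \<subseteq> T}" using less.prems(4) unfolding noncrossing_def by auto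
  qed (use that less.prems(3) in auto)
  \<comment> \<open>If the smallest vertex \<open>a\<close> has a neighbour other than the largest
    vertex \<open>b\<close>, the farthest such neighbour \<open>m\<close> splits the set: every edge
    except \<open>{a, b}\<close> lies in the part up to \<open>m\<close> or in the part from
    \<open>m\<close> on, and the parts share only \<open>m\<close>. Otherwise at most the edge
    \<open>{a, b}\<close> is lost by deleting \<open>a\<close>.\<close>
  define M where "M = {x \<in> S. {a, x} \<in> E \<and> x \<noteq> b}"
  show ?case
  proof (cases "M = {}")
    case True
    have sub: "E \<subseteq> insert {a, b} {e \<in> E. e \<subseteq> S - {a}}"
    proof
      fix e assume e: "e \<in> E"
      obtain x y where xy: "e = {x, y}" "x < y" "x \<in> S" "y \<in> S" using edge[OF e] by blast
      show "e \<in> insert {a, b} {e \<in> E. e \<subseteq> S - {a}}"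
      proof (cases "x = a")
        case True
        then have "y = b" using xy e \<open>M = {}\<close> unfolding M_def by auto
        then show ?thesis using True xy by simp
      next
        case False
        then have "a \<notin> e" using xy a by fastforce
        then show ?thesis using xy e by auto
      qed
    qed
    have "card E \<le> card (insert {a, b} {e \<in> E. e \<subseteq> S - {a}})"
      using card_mono[OF _ sub] finE by simp
    also have "\<dots> \<le> Suc (card {e \<in> E. e \<subseteq> S - {a}})" using finE by (simp add: card_insert_if)
    finally have c: "card E \<le> Suc (card {e \<in> E. e \<subseteq> S - {a}})" .
    show ?thesis
    proof (cases "card S = 2")
      case True
      then have "card (S - {a}) = 1" using a less.prems(1) by simp
      then have c1: "card (S - {a}) = 1" by simp
      have "False" if e: "e \<in> E" "e \<subseteq> S - {a}" for e
      proof -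
        have "card e \<le> card (S - {a})" by (rule card_mono[OF _ e(2)]) (simp add: less.prems(1))
        then show False using less.prems(3)[OF e(1)] c1 by linarith
      qed
      then have none: "{e \<in> E. e \<subseteq> S - {a}} = {}" by blast
      show ?thesis using c True unfolding none by simp
    next
      case False
      then have "card (S - {a}) \<ge> 2" "card (S - {a}) = card S - 1" using a less.prems(1,2) by auto
      moreover have "S - {a} \<subset> S" using a(1) by blast
      ultimately show ?thesis using IH[of "S - {a}"] c by linarith
    qed
  next
    case False
    define m where "m = Max M"
    have finM: "finite M" using less.prems(1) unfolding M_def by simp
    have m: "m \<in> S" "{a, m} \<in> E" "m \<noteq> b" and mmax: "\<And>x. x \<in> M \<Longrightarrow> x \<le> m"
      using Max_in[OF finM False] Max_ge[OF finM] unfolding m_def M_def by auto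
    have "m \<noteq> a" using less.prems(3)[OF m(2)] by auto
    then have am: "a < m" "m < b" using a(2)[OF m(1)] b(2)[OF m(1)] m(3) by auto
    define S1 S2 where "S1 = {x \<in> S. x \<le> m}" and "S2 = {x \<in> S. m \<le> x}"
    have fin: "finite S1" "finite S2" using less.prems(1) unfolding S1_def S2_def by auto
    have "S1 \<union> S2 = S" "S1 \<inter> S2 = {m}" using m unfolding S1_def S2_def by auto
    then have cs: "card S1 + card S2 = card S + 1" using card_Un_Int[OF fin] by simp
    have "{a, m} \<subseteq> S1" "{m, b} \<subseteq> S2" using a b m am unfolding S1_def S2_def by auto
    then have ge: "card S1 \<ge> 2" "card S2 \<ge> 2"
      using card_mono[OF fin(1), of "{a, m}"] card_mono[OF fin(2), of "{m, b}"] am by auto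
    have "b \<notin> S1" "a \<notin> S2" "S1 \<subseteq> S" "S2 \<subseteq> S" using am unfolding S1_def S2_def by auto
    then have "S1 \<subset> S" "S2 \<subset> S" using a(1) b(1) by blast+
    then have ih: "card {e \<in> E. e \<subseteq> S1} + 3 \<le> 2 * card S1" "card {e \<in> E. e \<subseteq> S2} + 3 \<le> 2 * card S2"
      using IH ge by auto
    have "E \<subseteq> insert {a, b} ({e \<in> E. e \<subseteq> S1} \<union> {e \<in> E. e \<subseteq> S2})"
    proof
      fix e assume e: "e \<in> E"
      obtain x y where xy: "e = {x, y}" "x < y" "x \<in> S" "y \<in> S" using edge[OF e] by blast
      consider "y \<le> m" | "m \<le> x" | "x < m" "m < y" by linarith
      then show "e \<in> insert {a, b} ({e \<in> E. e \<subseteq> S1} \<union> {e \<in> E. e \<subseteq> S2})"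
      proof cases
        case 1
        then show ?thesis using e xy unfolding S1_def by auto
      next
        case 2
        then show ?thesis using e xy unfolding S2_def by auto
      next
        case 3
        \<comment> \<open>An edge passing over \<open>m\<close> must start at \<open>a\<close>, or
          it would cross \<open>{a, m}\<close>, and end at \<open>b\<close>, or \<open>m\<close>
          would not be the farthest neighbour.\<close>
        have "x = a"
        proof (rule ccontr)
          assume "x \<noteq> a"
          then have "a < x" using a(2)[OF xy(3)] by simp
          then show False using noncrossingD[OF less.prems(4) m(2), of x y] e xy 3 by auto
        qed
        moreover have "y = b"
        proof (rule ccontr)
          assume "y \<noteq> b"
          then have "y \<in> M" using \<open>x = a\<close> xy e unfolding M_def by auto
          then show False using mmax 3 by force
        qed
        ultimately show ?thesis using xy by simp
      qed
    qed
    then have "card E \<le> card (insert {a, b} ({e \<in> E. e \<subseteq> S1} \<union> {e \<in> E. e \<subseteq> S2}))"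
      using finE by (intro card_mono) auto
    also have "\<dots> \<le> Suc (card ({e \<in> E. e \<subseteq> S1} \<union> {e \<in> E. e \<subseteq> S2}))"
      using finE by (simp add: card_insert_if)
    also have "\<dots> \<le> Suc (card {e \<in> E. e \<subseteq> S1} + card {e \<in> E. e \<subseteq> S2})"
      by (simp add: card_Un_le)
    finally show ?thesis using ih cs by linarith
  qed
qed

text \<open>Stated for the edges within a subset \<open>W\<close>, since it also has to bound the
  edges spanned by the vertices of large degree.\<close>

lemma outerplanar_card_edges:
  assumes "simple_graph V E" "outerplanar V E" "W \<subseteq> V" "card W \<ge> 2"
  shows "card {e \<in> E. e \<subseteq> W} + 3 \<le> 2 * card W"
proof -
  obtain f :: "'a \<Rightarrow> nat" where f: "inj_on f V" "noncrossing f E"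
    using assms outerplanar_iff_noncrossing by blast
  have W: "finite W" using assms finite_subset unfolding simple_graph_def by auto
  have injW: "inj_on f W" using f(1) assms(3) inj_on_subset by blast
  let ?E = "{e \<in> E. e \<subseteq> W}"
  have "card ((`) f ` ?E) + 3 \<le> 2 * card (f ` W)"
  proof (rule noncrossing_card_nat)
    show "finite (f ` W)" using W by simp
    show "card (f ` W) \<ge> 2" using assms card_image[OF injW] by simp
    fix e assume "e \<in> (`) f ` ?E"
    then obtain e' where e': "e = f ` e'" "e' \<in> E" "e' \<subseteq> W" by blast
    then have "card e = card e'" using injW by (metis card_image inj_on_subset)
    then show "e \<subseteq> f ` W \<and> card e = 2" using e' assms(1) unfolding simple_graph_def by auto
  next
    show "noncrossing id ((`) f ` ?E)" unfolding noncrossing_def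
    proof (intro allI impI notI)
      fix a b c d assume e: "{a, c} \<in> (`) f ` ?E" "{b, d} \<in> (`) f ` ?E"
        and l: "id a < id b \<and> id b < id c \<and> id c < id d"
      have pre: "\<exists>x y. f x = a \<and> f y = c \<and> {x, y} \<in> E" if ac: "{a, c} \<in> (`) f ` ?E" for a c
      proof -
        obtain e' where e': "{a, c} = f ` e'" "e' \<in> E" using ac by auto
        then obtain x y where "e' = {x, y}" using assms(1) unfolding simple_graph_def by (meson card_2_iff)
        moreover from this have "{y, x} \<in> E" "{x, y} \<in> E" using e' by (auto simp: insert_commute)
        ultimately show ?thesis using e' by (auto simp: doubleton_eq_iff)
      qed
      obtain x y where "f x = a" "f y = c" "{x, y} \<in> E" using pre[OF e(1)] by blast
      moreover obtain x' y' where "f x' = b" "f y' = d" "{x', y'} \<in> E" using pre[OF e(2)] by blast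
      ultimately show False using noncrossingD[OF f(2), of x y x' y'] l by auto
    qed
  qed
  moreover have "card ((`) f ` ?E) = card ?E"
    by (intro card_image inj_onI) (use injW in \<open>auto simp: inj_on_image_eq_iff\<close>)
  ultimately show ?thesis using card_image[OF injW] by simp
qed

section \<open>Maximal outerplanar graphs\<close>

lemma card_filter_sum: "finite V \<Longrightarrow> card {v \<in> V. P v} = (\<Sum>v\<in>V. if P v then 1 else 0)"
  by (simp add: sum.If_cases Int_def)

lemma sum_degree:
  assumes "finite E" "finite S"
  shows "(\<Sum>v\<in>S. degree E v) = (\<Sum>e\<in>E. card (e \<inter> S))"
proof -
  have "(\<Sum>v\<in>S. degree E v) = (\<Sum>v\<in>S. \<Sum>e\<in>E. if v \<in> e then 1 else 0)"
    unfolding degree_def using card_filter_sum[OF assms(1)] by simp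
  also have "\<dots> = (\<Sum>e\<in>E. \<Sum>v\<in>S. if v \<in> e then 1 else 0)" by (rule sum.swap)
  also have "\<dots> = (\<Sum>e\<in>E. card (e \<inter> S))"
  proof (rule sum.cong)
    fix e
    have "{v \<in> S. v \<in> e} = e \<inter> S" by auto
    then show "(\<Sum>v\<in>S. if v \<in> e then 1 else 0) = card (e \<inter> S)"
      using card_filter_sum[OF assms(2), of "\<lambda>v. v \<in> e"] by simp
  qed simp
  finally show ?thesis .
qed

lemma finite_edges: "simple_graph V E \<Longrightarrow> finite E"
  unfolding simple_graph_def by (meson PowI finite_Pow_iff finite_subset subsetI)

text \<open>Sets of spread at most \<open>k\<close> are replaced by windows of \<open>k + 1\<close>
  consecutive degrees, here for lower bounds and in \<open>sp_le\<close> for upper bounds.\<close>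

lemma card_le_sp:
  assumes "finite V" "W \<subseteq> V" "\<And>v. v \<in> W \<Longrightarrow> d \<le> degree E v \<and> degree E v \<le> d + k"
  shows "card W \<le> sp V E k"
proof (cases "W = {}")
  case False
  have fin: "finite W" using assms finite_subset by blast
  then have "Max (degree E ` W) \<le> d + k" "Min (degree E ` W) \<ge> d" using False assms(3) by auto
  then have "spread E W \<le> k" unfolding spread_def by linarith
  then have "card W \<in> {card B | B. B \<subseteq> V \<and> B \<noteq> {} \<and> spread E B \<le> k}" using assms(2) False by blast
  moreover have "finite {card B | B. B \<subseteq> V \<and> B \<noteq> {} \<and> spread E B \<le> k}"
    by (rule finite_subset[of _ "card ` Pow V"]) (use assms(1) in auto)
  ultimately show ?thesis unfolding sp_def by (rule Max_ge[rotated])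
qed simp

lemma sp_le:
  assumes "finite V" "V \<noteq> {}" "\<And>d. card {v \<in> V. d \<le> degree E v \<and> degree E v \<le> d + k} \<le> M"
  shows "sp V E k \<le> M"
proof -
  let ?S = "{card B | B. B \<subseteq> V \<and> B \<noteq> {} \<and> spread E B \<le> k}"
  have "finite ?S" by (rule finite_subset[of _ "card ` Pow V"]) (use assms(1) in auto)
  moreover obtain v where "v \<in> V" using assms(2) by blast
  then have "card {v} \<in> ?S" unfolding spread_def by (intro CollectI exI[of _ "{v}"]) auto
  then have "?S \<noteq> {}" by blast
  moreover have "c \<le> M" if "c \<in> ?S" for c
  proof -
    obtain B where B: "c = card B" "B \<subseteq> V" "B \<noteq> {}" "spread E B \<le> k" using \<open>c \<in> ?S\<close> by blast
    have fin: "finite B" using B(2) assms(1) finite_subset by blast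
    let ?d = "Min (degree E ` B)"
    have "?d \<le> degree E v \<and> degree E v \<le> ?d + k" if "v \<in> B" for v
    proof -
      have "?d \<le> degree E v" "degree E v \<le> Max (degree E ` B)" using that fin by auto
      then show ?thesis using B(4) unfolding spread_def by linarith
    qed
    then have "B \<subseteq> {v \<in> V. ?d \<le> degree E v \<and> degree E v \<le> ?d + k}" using B(2) by blast
    then have "card B \<le> card {v \<in> V. ?d \<le> degree E v \<and> degree E v \<le> ?d + k}"
      using assms(1) by (intro card_mono) auto
    then show ?thesis using assms(3)[of ?d] B(1) by linarith
  qed
  ultimately show ?thesis unfolding sp_def by (subst Max_le_iff) auto
qed

text \<open>Ensures that the set under \<open>Inf\<close> in \<open>MOP\<close> is nonempty, so that
  \<open>MOP n k\<close> is attained and inherits every lower bound for \<open>sp\<close>.\<close>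

lemma maximal_outerplanar_exists: "\<exists>(V :: nat set) E. maximal_outerplanar V E \<and> card V = n"
proof -
  define V where "V = {..<n}"
  define S where "S = {E. simple_graph V E \<and> outerplanar V E}"
  have "S \<subseteq> Pow (Pow V)" unfolding S_def simple_graph_def by auto
  then have "finite S" unfolding V_def by (rule finite_subset) simp
  have "simple_graph V {}" unfolding simple_graph_def V_def by simp
  moreover have "inj_on id V" "noncrossing id ({} :: nat set set)" unfolding noncrossing_def by auto
  ultimately have "{} \<in> S" unfolding S_def using noncrossing_imp_outerplanar by blast
  then obtain E where E: "E \<in> S" "\<And>F. F \<in> S \<Longrightarrow> E \<subseteq> F \<Longrightarrow> E = F"
    using finite_has_maximal[OF \<open>finite S\<close>] by blast
  have "\<not> outerplanar V (insert {u, v} E)" if "u \<in> V" "v \<in> V" "u \<noteq> v \<and> {u, v} \<notin> E" for u v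
  proof
    assume "outerplanar V (insert {u, v} E)"
    moreover have "simple_graph V (insert {u, v} E)" using E(1) that unfolding S_def simple_graph_def by auto
    ultimately have "E = insert {u, v} E" using E(2) unfolding S_def by blast
    then show False using that by blast
  qed
  then have "maximal_outerplanar V E" using E(1) unfolding maximal_outerplanar_def S_def by blast
  then show ?thesis unfolding V_def by (intro exI[of _ "{..<n}"] exI[of _ E]) simp
qed

lemma MOP_ge:
  assumes "\<And>(V :: nat set) E. maximal_outerplanar V E \<Longrightarrow> card V = n \<Longrightarrow> x \<le> real (sp V E k)"
  shows "x \<le> real (MOP n k)"
proof -
  have "{sp V E k | (V :: nat set) E. maximal_outerplanar V E \<and> card V = n} \<noteq> {}"
    using maximal_outerplanar_exists[of n] by blast
  from Inf_nat_def1[OF this] show ?thesis using assms unfolding MOP_def by force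
qed

lemma MOP_le:
  fixes V :: "nat set"
  assumes "maximal_outerplanar V E" "card V = n"
  shows "MOP n k \<le> sp V E k"
  unfolding MOP_def by (rule wellorder_Inf_le1) (use assms in blast)

text \<open>Positions become ranks from 0 to \<open>card V - 1\<close>, so that consecutive vertices
  have consecutive numbers.\<close>

lemma order_rank:
  assumes "finite V" "inj_on f V"
  obtains r :: "'a \<Rightarrow> nat" where "bij_betw r V {..<card V}"
    "\<And>u v. u \<in> V \<Longrightarrow> v \<in> V \<Longrightarrow> r u < r v \<Longrightarrow> f u < (f v :: nat)"
proof -
  define r where "r v = card {u \<in> V. f u < f v}" for v
  have mono: "r u < r v" if "f u < f v" "u \<in> V" for u v
    unfolding r_def by (rule psubset_card_mono) (use assms(1) that in auto)
  have conv: "f u < f v" if "u \<in> V" "v \<in> V" "r u < r v" for u v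
    using mono[of v u] that assms(2) by (metis inj_onD less_asym less_irrefl linorder_neqE_nat)
  have inj: "inj_on r V"
    using mono assms(2) by (metis (no_types, lifting) inj_onI inj_onD less_irrefl linorder_neqE_nat)
  have "r v < card V" if "v \<in> V" for v
    unfolding r_def by (rule psubset_card_mono) (use assms(1) that in auto)
  then have "r ` V \<subseteq> {..<card V}" by auto
  then have "r ` V = {..<card V}" by (intro card_subset_eq) (auto simp: card_image[OF inj])
  then show thesis using that[of r] inj conv unfolding bij_betw_def by blast
qed

text \<open>No vertex lies between two cyclically consecutive ones, so an edge joining them
  alternates with no other edge; by maximality it is already present.\<close>

lemma maximal_outerplanar_Hamiltonian:
  assumes "maximal_outerplanar V E" "card V \<ge> 2"
  obtains g :: "nat \<Rightarrow> 'a" where "bij_betw g {..<card V} V"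
    "\<And>i. i < card V \<Longrightarrow> {g i, g (Suc i mod card V)} \<in> E"
proof -
  let ?n = "card V"
  have G: "simple_graph V E" and op: "outerplanar V E"
    and mx: "\<And>u v. u \<in> V \<Longrightarrow> v \<in> V \<Longrightarrow> u \<noteq> v \<Longrightarrow> {u, v} \<notin> E \<Longrightarrow> \<not> outerplanar V (insert {u, v} E)"
    using assms(1) unfolding maximal_outerplanar_def by auto
  have fin: "finite V" using G unfolding simple_graph_def by blast
  obtain f :: "'a \<Rightarrow> nat" where f: "inj_on f V" "noncrossing f E"
    using G op outerplanar_iff_noncrossing by blast
  obtain r :: "'a \<Rightarrow> nat" where r: "bij_betw r V {..<?n}"
    "\<And>u v. u \<in> V \<Longrightarrow> v \<in> V \<Longrightarrow> r u < r v \<Longrightarrow> f u < f v"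
    using order_rank[OF fin f(1)] by metis
  define g where "g = inv_into V r"
  have bij: "bij_betw g {..<?n} V" unfolding g_def using r(1) by (rule bij_betw_inv_into)
  have rg: "r (g i) = i" "g i \<in> V" if "i < ?n" for i
    using r(1) that bij unfolding g_def by (auto simp: bij_betw_inv_into_right bij_betw_def)
  have rV: "r v < ?n" if "v \<in> V" for v using r(1) that unfolding bij_betw_def by auto
  have "{g i, g (Suc i mod ?n)} \<in> E" if i: "i < ?n" for i
  proof (rule ccontr)
    assume notE: "{g i, g (Suc i mod ?n)} \<notin> E"
    let ?u = "g i" and ?w = "g (Suc i mod ?n)"
    have m: "Suc i mod ?n < ?n" using i by simp
    have "Suc i mod ?n \<noteq> i" using i assms(2) by (auto simp: mod_Suc split: if_splits)
    then have uw: "?u \<in> V" "?w \<in> V" "?u \<noteq> ?w" using rg i m by metis+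
    have "simple_graph V (insert {?u, ?w} E)" using G uw unfolding simple_graph_def by auto
    moreover have "inj_on r V" using r(1) unfolding bij_betw_def by blast
    moreover have "noncrossing r (insert {?u, ?w} E)" unfolding noncrossing_def
    proof (intro allI impI notI)
      fix a b c d assume e: "{a, c} \<in> insert {?u, ?w} E" "{b, d} \<in> insert {?u, ?w} E"
        and l: "r a < r b \<and> r b < r c \<and> r c < r d"
      have EV: "e \<subseteq> V" if "e \<in> insert {?u, ?w} E" for e using that uw G unfolding simple_graph_def by auto
      have V: "a \<in> V" "b \<in> V" "c \<in> V" "d \<in> V" using EV[OF e(1)] EV[OF e(2)] by auto
      \<comment> \<open>Neighbouring ranks, or the last and the first: on one side no vertex
        separates \<open>?u\<close> from \<open>?w\<close>, whereas each pair of an alternating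
        quadruple is separated on both sides.\<close>
      have step: "r ?w = Suc (r ?u) \<or> (r ?w = 0 \<and> Suc (r ?u) = ?n)"
        using rg(1)[OF i] rg(1)[OF m] i by (auto simp: mod_Suc split: if_splits)
      have "{a, c} \<noteq> {?u, ?w}"
        using step l rV[OF V(4)] by (auto simp: doubleton_eq_iff)
      moreover have "{b, d} \<noteq> {?u, ?w}"
        using step l by (auto simp: doubleton_eq_iff)
      ultimately have "{a, c} \<in> E" "{b, d} \<in> E" using e by auto
      then show False using noncrossingD[OF f(2), of a c b d] r(2) V l by blast
    qed
    ultimately have "outerplanar V (insert {?u, ?w} E)" by (rule noncrossing_imp_outerplanar)
    then show False using mx uw notE by blast
  qed
  then show thesis using that bij by blast
qed

context
  fixes V :: "'a set" and E
  assumes max: "maximal_outerplanar V E" and n3: "card V \<ge> 3"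
begin

lemma maximal_graph: "simple_graph V E" "outerplanar V E" "finite V" "finite E"
  using max finite_edges unfolding maximal_outerplanar_def simple_graph_def by auto

lemma maximal_card_edges: "card E + 3 \<le> 2 * card V"
proof -
  have "{e \<in> E. e \<subseteq> V} = E" using maximal_graph(1) unfolding simple_graph_def by auto
  then show ?thesis using outerplanar_card_edges[OF maximal_graph(1,2), of V] n3 by simp
qed

lemma maximal_sum_degree: "(\<Sum>v\<in>V. degree E v) + 6 \<le> 4 * card V"
proof -
  have "(\<Sum>v\<in>V. degree E v) = (\<Sum>e\<in>E. card (e \<inter> V))"
    using sum_degree maximal_graph by blast
  also have "\<dots> = (\<Sum>e\<in>E. 2)"
    by (rule sum.cong) (use maximal_graph(1) in \<open>auto simp: simple_graph_def Int_absorb2\<close>)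
  finally show ?thesis using maximal_card_edges by simp
qed

text \<open>Edges are indexed by their starting point on the cycle. Injectivity requires three
  vertices, since on two the cycle would run through a single edge twice.\<close>

lemma Hamiltonian_edges:
  obtains h where "inj_on h {..<card V}" "\<And>i. i < card V \<Longrightarrow> h i \<in> E"
    "\<And>v. v \<in> V \<Longrightarrow> card {i. i < card V \<and> v \<in> h i} = 2"
proof -
  let ?n = "card V"
  have "card V \<ge> 2" using n3 by simp
  then obtain g where g: "bij_betw g {..<?n} V" "\<And>i. i < ?n \<Longrightarrow> {g i, g (Suc i mod ?n)} \<in> E"
    using maximal_outerplanar_Hamiltonian[OF max] by blast
  define h where "h i = {g i, g (Suc i mod ?n)}" for i
  have injg: "g i = g j \<longleftrightarrow> i = j" if "i < ?n" "j < ?n" for i j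
    using g(1) that unfolding bij_betw_def by (auto dest: inj_onD)
  have lt: "Suc i mod ?n < ?n" for i using n3 by simp
  have "inj_on h {..<?n}"
  proof (rule inj_onI)
    fix i j assume "i \<in> {..<?n}" "j \<in> {..<?n}" "h i = h j"
    then show "i = j" using n3 unfolding h_def
      by (auto simp: doubleton_eq_iff injg lt mod_Suc split: if_splits)
  qed
  moreover have "card {i. i < ?n \<and> v \<in> h i} = 2" if "v \<in> V" for v
  proof -
    obtain j where j: "j < ?n" "v = g j" using g(1) \<open>v \<in> V\<close> unfolding bij_betw_def by auto
    define j' where "j' = (if j = 0 then ?n - 1 else j - 1)"
    have "{i. i < ?n \<and> v \<in> h i} = {j, j'}"
    proof -
      have "i < ?n \<and> v \<in> h i \<longleftrightarrow> i < ?n \<and> (i = j \<or> Suc i mod ?n = j)" for i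
        unfolding h_def j(2) using injg[OF j(1)] lt by auto
      moreover have "i < ?n \<and> (i = j \<or> Suc i mod ?n = j) \<longleftrightarrow> i \<in> {j, j'}" for i
        using j(1) n3 unfolding j'_def by (auto simp: mod_Suc split: if_splits)
      ultimately show ?thesis by blast
    qed
    moreover have "j \<noteq> j'" using j(1) n3 unfolding j'_def by auto
    ultimately show ?thesis by simp
  qed
  ultimately show thesis using that[of h] g(2) unfolding h_def by blast
qed

lemma maximal_degree_ge: "v \<in> V \<Longrightarrow> degree E v \<ge> 2"
proof -
  assume v: "v \<in> V"
  obtain h where h: "inj_on h {..<card V}" "\<And>i. i < card V \<Longrightarrow> h i \<in> E"
    "\<And>v. v \<in> V \<Longrightarrow> card {i. i < card V \<and> v \<in> h i} = 2" using Hamiltonian_edges by metis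
  have "card (h ` {i. i < card V \<and> v \<in> h i}) = 2"
    using h(3)[OF v] h(1) by (subst card_image) (auto simp: inj_on_def)
  moreover have "card (h ` {i. i < card V \<and> v \<in> h i}) \<le> card {e \<in> E. v \<in> e}"
    by (rule card_mono) (use h(2) maximal_graph(4) in auto)
  ultimately show ?thesis unfolding degree_def by simp
qed

lemma maximal_sum_degree_subset:
  assumes "H \<subseteq> V"
  shows "(\<Sum>v\<in>H. degree E v) \<le> card V + 4 * card H"
proof -
  let ?n = "card V"
  have finH: "finite H" using assms maximal_graph(3) finite_subset by blast
  obtain h where h: "inj_on h {..<?n}" "\<And>i. i < ?n \<Longrightarrow> h i \<in> E"
    "\<And>v. v \<in> V \<Longrightarrow> card {i. i < ?n \<and> v \<in> h i} = 2" using Hamiltonian_edges by metis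
  have card2: "card e = 2" if "e \<in> E" for e using maximal_graph(1) that unfolding simple_graph_def by auto
  let ?T = "{e \<in> E. e \<inter> H \<noteq> {}}" and ?I = "{e \<in> E. e \<subseteq> H}"
  \<comment> \<open>An edge contributes one to the degree sum over \<open>H\<close> for meeting
    \<open>H\<close> and one more for lying in \<open>H\<close>.\<close>
  have split: "card (e \<inter> H) = (if e \<inter> H \<noteq> {} then 1 else 0) + (if e \<subseteq> H then 1 else 0)" if "e \<in> E" for e
  proof -
    obtain x y where "e = {x, y}" "x \<noteq> y" using card2[OF \<open>e \<in> E\<close>] by (meson card_2_iff)
    then show ?thesis by (cases "x \<in> H"; cases "y \<in> H") auto
  qed
  have "(\<Sum>v\<in>H. degree E v) = (\<Sum>e\<in>E. card (e \<inter> H))"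
    by (rule sum_degree[OF maximal_graph(4) finH])
  also have "\<dots> = card ?T + card ?I"
    using split by (simp add: card_filter_sum[OF maximal_graph(4)] sum.distrib)
  finally have deg: "(\<Sum>v\<in>H. degree E v) = card ?T + card ?I" .
  have I: "card ?I \<le> 2 * card H"
  proof (cases "card H \<ge> 2")
    case True
    then show ?thesis using outerplanar_card_edges[OF maximal_graph(1,2) assms] by linarith
  next
    case False
    have "\<not> e \<subseteq> H" if "e \<in> E" for e
      using card_mono[OF finH, of e] card2[OF that] False by linarith
    then have none: "?I = {}" by blast
    show ?thesis unfolding none by simp
  qed
  have hit: "card {i \<in> {..<?n}. h i \<inter> H \<noteq> {}} \<le> 2 * card H"
  proof -
    have "{i \<in> {..<?n}. h i \<inter> H \<noteq> {}} \<subseteq> (\<Union>v\<in>H. {i. i < ?n \<and> v \<in> h i})" by auto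
    then have "card {i \<in> {..<?n}. h i \<inter> H \<noteq> {}} \<le> card (\<Union>v\<in>H. {i. i < ?n \<and> v \<in> h i})"
      using finH by (intro card_mono) auto
    also have "\<dots> \<le> (\<Sum>v\<in>H. card {i. i < ?n \<and> v \<in> h i})" by (rule card_UN_le[OF finH])
    also have "\<dots> = (\<Sum>v\<in>H. 2)" by (rule sum.cong) (use h(3) assms in auto)
    finally show ?thesis by simp
  qed
  let ?A = "{i \<in> {..<?n}. h i \<inter> H = {}}"
  have "card {i \<in> {..<?n}. h i \<inter> H \<noteq> {}} + card ?A = card ({i \<in> {..<?n}. h i \<inter> H \<noteq> {}} \<union> ?A)"
    by (rule card_Un_disjoint[symmetric]) auto
  also have "{i \<in> {..<?n}. h i \<inter> H \<noteq> {}} \<union> ?A = {..<?n}" by auto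
  finally have "card {i \<in> {..<?n}. h i \<inter> H \<noteq> {}} + card ?A = ?n" by simp
  moreover have "card ?T + card (h ` ?A) \<le> card E"
  proof -
    have "card ?T + card (h ` ?A) = card (?T \<union> h ` ?A)"
      by (rule card_Un_disjoint[symmetric]) (use maximal_graph(4) in auto)
    also have "\<dots> \<le> card E" by (rule card_mono) (use h(2) maximal_graph(4) in auto)
    finally show ?thesis .
  qed
  moreover have "card (h ` ?A) = card ?A"
    by (rule card_image) (use h(1) in \<open>auto simp: inj_on_def\<close>)
  ultimately show ?thesis using deg I hit maximal_card_edges by linarith
qed

end

section \<open>Lower bounds\<close>

text \<open>Settles the graphs too small for the Hamiltonian cycle argument: every edge is then all
  of \<open>V\<close>, so all degrees agree and \<open>V\<close> itself has spread 0.\<close>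

lemma card_le_sp_small:
  assumes "simple_graph V E" "card V \<le> 2"
  shows "card V \<le> sp V E k"
proof (cases "card V = 0")
  case False
  have fin: "finite V" and E: "\<And>e. e \<in> E \<Longrightarrow> e \<subseteq> V \<and> card e = 2"
    using assms(1) unfolding simple_graph_def by auto
  have "e = V" if "e \<in> E" for e
    using card_subset_eq[OF fin, of e] E[OF that] card_mono[OF fin, of e] assms(2) by simp
  then have "{e \<in> E. v \<in> e} = E" if "v \<in> V" for v using that by blast
  then have "degree E v = card E" if "v \<in> V" for v using that unfolding degree_def by simp
  then show ?thesis by (intro card_le_sp[OF fin order_refl, of "card E"]) auto
qed simp

context
  fixes V :: "'a set" and E
  assumes max: "maximal_outerplanar V E" and n3: "card V \<ge> 3"
begin

lemma window_le_sp: "card {v \<in> V. d \<le> degree E v \<and> degree E v \<le> d + k} \<le> sp V E k"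
  by (rule card_le_sp[of _ _ d]) (use maximal_graph[OF max n3] in auto)

text \<open>The weight \<open>w\<close> tops every degree up to \<open>c\<close>; since the degrees
  average less than 4, any \<open>c > 4\<close> forces a large total weight, hence many vertices of
  small degree.\<close>

lemma sum_degree_bound:
  assumes "\<And>m. m \<ge> 2 \<Longrightarrow> c \<le> m + w m"
  shows "c * card V + 6 \<le> 4 * card V + (\<Sum>v\<in>V. w (degree E v))"
proof -
  have "(\<Sum>v\<in>V. c) \<le> (\<Sum>v\<in>V. degree E v + w (degree E v))"
    by (rule sum_mono) (use assms maximal_degree_ge[OF max n3] in blast)
  then show ?thesis using maximal_sum_degree[OF max n3] by (simp add: sum.distrib mult.commute)
qed

lemma window_sum: "(\<Sum>v\<in>V. if d \<le> degree E v \<and> degree E v \<le> d + k then 1 else 0) \<le> sp V E k"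
  using window_le_sp[of d k] card_filter_sum[OF maximal_graph(3)[OF max n3]] by simp

text \<open>Topping up to \<open>c\<close> costs at most \<open>1 + ... + (c - 2)\<close> times
  \<open>sp\<close> and gains \<open>c - 4\<close> per vertex; the ratio of gain to cost is at most
  1/5, attained at \<open>c = 6\<close>.\<close>

lemma sp_0_lower: "card V < 5 * sp V E 0"
proof -
  let ?i = "\<lambda>d m. if d \<le> m \<and> m \<le> d + 0 then 1 else 0 :: nat"
  have "6 * card V + 6 \<le> 4 * card V +
      (\<Sum>v\<in>V. 4 * ?i 2 (degree E v) + 3 * ?i 3 (degree E v) + 2 * ?i 4 (degree E v) + ?i 5 (degree E v))"
    by (rule sum_degree_bound) auto
  also have "\<dots> \<le> 4 * card V + (4 * sp V E 0 + 3 * sp V E 0 + 2 * sp V E 0 + sp V E 0)"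
    unfolding sum.distrib sum_distrib_left[symmetric]
    by (intro add_mono mult_le_mono order_refl window_sum)
  finally show ?thesis by simp
qed

text \<open>A weight that is constant on a window has to serve its smallest degree: 4 on degrees 2
  and 3, and 2 on degrees 4 and 5, a total of 6 against a gain of 2 per vertex.\<close>

lemma sp_1_lower: "card V + 3 \<le> 3 * sp V E 1"
proof -
  let ?i = "\<lambda>d m. if d \<le> m \<and> m \<le> d + 1 then 1 else 0 :: nat"
  have "6 * card V + 6 \<le> 4 * card V + (\<Sum>v\<in>V. 4 * ?i 2 (degree E v) + 2 * ?i 4 (degree E v))"
    by (rule sum_degree_bound) auto
  also have "\<dots> \<le> 4 * card V + (4 * sp V E 1 + 2 * sp V E 1)"
    unfolding sum.distrib sum_distrib_left[symmetric]
    by (intro add_mono mult_le_mono order_refl window_sum)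
  finally show ?thesis by simp
qed

text \<open>Here \<open>c = 8\<close> is the best choice: weight 6 on degrees 2 to 4 and 3 on
  degrees 5 to 7 give 4/9, while \<open>c = 7\<close> gives only 3/7 and \<open>c = 9\<close> only
  5/12.\<close>

lemma sp_2_lower: "4 * card V \<le> 9 * sp V E 2"
proof -
  let ?i = "\<lambda>d m. if d \<le> m \<and> m \<le> d + 2 then 1 else 0 :: nat"
  have "8 * card V + 6 \<le> 4 * card V + (\<Sum>v\<in>V. 6 * ?i 2 (degree E v) + 3 * ?i 5 (degree E v))"
    by (rule sum_degree_bound) auto
  also have "\<dots> \<le> 4 * card V + (6 * sp V E 2 + 3 * sp V E 2)"
    unfolding sum.distrib sum_distrib_left[symmetric]
    by (intro add_mono mult_le_mono order_refl window_sum)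
  finally show ?thesis by simp
qed

lemma sp_ge_3_lower:
  assumes "k \<ge> 3"
  shows "(k - 2) * card V \<le> (k - 1) * sp V E k"
proof -
  define H where "H = {v \<in> V. degree E v \<ge> k + 3}"
  \<comment> \<open>All degrees are at least 2, so this window misses exactly
    \<open>H\<close>.\<close>
  let ?W = "{v \<in> V. 2 \<le> degree E v \<and> degree E v \<le> 2 + k}"
  have fin: "finite V" using maximal_graph[OF max n3] by blast
  have "(k + 3) * card H \<le> (\<Sum>v\<in>H. degree E v)"
    using sum_bounded_below[of H "k + 3" "degree E"] unfolding H_def by (simp add: mult.commute)
  also have "\<dots> \<le> card V + 4 * card H"
    by (rule maximal_sum_degree_subset[OF max n3]) (auto simp: H_def)
  finally have H: "(k - 1) * card H \<le> card V" using assms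
    by (cases k) (auto simp: algebra_simps)
  have "?W \<union> H = V" unfolding H_def using maximal_degree_ge[OF max n3] by auto
  then have "card V \<le> card ?W + card H" using card_Un_le[of ?W H] by simp
  then have "card V \<le> sp V E k + card H" using window_le_sp[of 2 k] by linarith
  then have "(k - 1) * card V \<le> (k - 1) * sp V E k + (k - 1) * card H"
    by (metis mult_le_mono2 add_mult_distrib2)
  then have "(k - 1) * card V \<le> (k - 1) * sp V E k + card V" using H by linarith
  moreover have "(k - 1) * card V = (k - 2) * card V + card V"
    using assms by (cases k; cases "k - 1") (auto simp: algebra_simps)
  ultimately show ?thesis by linarith
qed

end

section \<open>Triangulated polygons and upper bounds\<close>

text \<open>A triangulated polygon with vertices \<open>a, \<dots>, a + width t\<close>: the root edge joins the two extreme
  vertices, and \<open>Tri l r\<close> has the apex of the triangle on the root edge at \<open>a + width l\<close>.\<close>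

datatype triangulation = Edge | Tri triangulation triangulation

fun width :: "triangulation \<Rightarrow> nat" where
  "width Edge = 1"
| "width (Tri l r) = width l + width r"

fun edges_from :: "triangulation \<Rightarrow> nat \<Rightarrow> nat set set" where
  "edges_from Edge a = {{a, a + 1}}"
| "edges_from (Tri l r) a =
     insert {a, a + width l + width r} (edges_from l a \<union> edges_from r (a + width l))"

fun ldeg :: "triangulation \<Rightarrow> nat" where
  "ldeg Edge = 1"
| "ldeg (Tri l r) = Suc (ldeg l)"

fun rdeg :: "triangulation \<Rightarrow> nat" where
  "rdeg Edge = 1"
| "rdeg (Tri l r) = Suc (rdeg r)"

text \<open>Number of vertices of degree \<open>d\<close> off the root edge.\<close>

fun inner_count :: "triangulation \<Rightarrow> nat \<Rightarrow> nat" where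
  "inner_count Edge d = 0"
| "inner_count (Tri l r) d =
     inner_count l d + inner_count r d + (if rdeg l + ldeg r = d then 1 else 0)"

lemma width_pos: "width t \<ge> 1"
  by (induction t) auto

lemma edges_from_range:
  "e \<in> edges_from t a \<Longrightarrow> \<exists>i j. e = {i, j} \<and> a \<le> i \<and> i < j \<and> j \<le> a + width t"
proof (induction t arbitrary: a)
  case (Tri l r)
  then consider "e = {a, a + width l + width r}" | "e \<in> edges_from l a" | "e \<in> edges_from r (a + width l)"
    by auto
  then show ?case
  proof cases
    case 1
    then show ?thesis using width_pos[of l] by (intro exI[of _ a] exI[of _ "a + width l + width r"]) auto
  next
    case 2
    then obtain i j where "e = {i, j}" "a \<le> i" "i < j" "j \<le> a + width l" using Tri.IH(1) by blast
    then show ?thesis by (intro exI[of _ i] exI[of _ j]) auto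
  next
    case 3
    then obtain i j where "e = {i, j}" "a + width l \<le> i" "i < j" "j \<le> a + width l + width r"
      using Tri.IH(2) by blast
    then show ?thesis by (intro exI[of _ i] exI[of _ j]) auto
  qed
qed auto

lemma edges_from_pair:
  assumes "{x, y} \<in> edges_from t a" "x < y"
  shows "a \<le> x" "y \<le> a + width t"
  using edges_from_range[OF assms(1)] assms(2) by (auto simp: doubleton_eq_iff)

lemma edges_from_subset: "e \<in> edges_from t a \<Longrightarrow> e \<subseteq> {a..a + width t} \<and> card e = 2"
  using edges_from_range[of e t a] by auto

lemma finite_edges_from: "finite (edges_from t a)"
  by (induction t arbitrary: a) auto

lemma noncrossing_edges_from: "noncrossing id (edges_from t a)"
proof (induction t arbitrary: a)
  case Edge
  show ?case unfolding noncrossing_def by (auto simp: doubleton_eq_iff)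
next
  case (Tri l r)
  let ?m = "a + width l" and ?b = "a + width l + width r"
  show ?case unfolding noncrossing_def
  proof (intro allI impI notI)
    fix w x y z
    assume e: "{w, y} \<in> edges_from (Tri l r) a" "{x, z} \<in> edges_from (Tri l r) a"
      and "id w < id x \<and> id x < id y \<and> id y < id z"
    then have l: "w < x" "x < y" "y < z" by auto
    have range: "a \<le> w" "y \<le> ?b" "a \<le> x" "z \<le> ?b"
      using edges_from_pair[OF e(1)] edges_from_pair[OF e(2)] l by (auto simp: add.assoc)
    \<comment> \<open>The root edge joins the two extreme vertices and alternates with no edge, so
      both edges come from the sides \<open>l\<close> and \<open>r\<close>.\<close>
    have wy: "{w, y} \<in> edges_from l a \<or> {w, y} \<in> edges_from r ?m"
      using e(1) l range by (auto simp: doubleton_eq_iff)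
    have xz: "{x, z} \<in> edges_from l a \<or> {x, z} \<in> edges_from r ?m"
      using e(2) l range by (auto simp: doubleton_eq_iff)
    have both: "\<not> ({w, y} \<in> edges_from t c \<and> {x, z} \<in> edges_from t c)" if "noncrossing id (edges_from t c)" for t c
      using noncrossingD[OF that, of w y x z] l by auto
    show False
      using wy
    proof
      assume wy: "{w, y} \<in> edges_from l a"
      then have "{x, z} \<in> edges_from r ?m" using both[OF Tri.IH(1)] xz by blast
      then show False using edges_from_pair[OF wy] edges_from_pair[of x z r ?m] l by auto
    next
      assume wy: "{w, y} \<in> edges_from r ?m"
      then have "{x, z} \<in> edges_from l a" using both[OF Tri.IH(2)] xz by blast
      then show False using edges_from_pair[OF wy] edges_from_pair[of x z l a] l by auto
    qed
  qed
qed

lemma edges_from_Tri_disjoint: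
  "{a, a + width l + width r} \<notin> edges_from l a \<union> edges_from r (a + width l)"
  "edges_from l a \<inter> edges_from r (a + width l) = {}"
proof -
  have "\<not> {a, a + width l + width r} \<subseteq> {a..a + width l}" using width_pos[of r] by auto
  moreover have "\<not> {a, a + width l + width r} \<subseteq> {a + width l..a + width l + width r}" using width_pos[of l] by auto
  ultimately show "{a, a + width l + width r} \<notin> edges_from l a \<union> edges_from r (a + width l)"
    using edges_from_subset by blast
  have False if e: "e \<in> edges_from l a" "e \<in> edges_from r (a + width l)" for e
  proof -
    have "{a..a + width l} \<inter> {a + width l..a + width l + width r} = {a + width l}" by auto
    then have "e \<subseteq> {a + width l}" using edges_from_subset[OF e(1)] edges_from_subset[OF e(2)] by blast
    then have "card e \<le> 1" using card_mono[of "{a + width l}" e] by simp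
    then show False using edges_from_subset[OF e(1)] by simp
  qed
  then show "edges_from l a \<inter> edges_from r (a + width l) = {}" by blast
qed

lemma card_edges_from: "Suc (card (edges_from t a)) = 2 * width t"
proof (induction t arbitrary: a)
  case (Tri l r)
  have "card (edges_from (Tri l r) a) = Suc (card (edges_from l a \<union> edges_from r (a + width l)))"
    using edges_from_Tri_disjoint(1)[of a l r] finite_edges_from by simp
  also have "\<dots> = Suc (card (edges_from l a) + card (edges_from r (a + width l)))"
    using edges_from_Tri_disjoint(2) finite_edges_from by (simp add: card_Un_disjoint)
  finally show ?case using Tri.IH(1)[of a] Tri.IH(2)[of "a + width l"] by simp
qed simp

lemma degree_edges_from_Tri:
  "degree (edges_from (Tri l r) a) v = (if v \<in> {a, a + width l + width r} then 1 else 0)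
    + degree (edges_from l a) v + degree (edges_from r (a + width l)) v"
proof -
  let ?e = "{a, a + width l + width r}" and ?L = "edges_from l a" and ?R = "edges_from r (a + width l)"
  have fin: "finite ?L" "finite ?R" by (rule finite_edges_from)+
  have "{e \<in> edges_from (Tri l r) a. v \<in> e} = {e \<in> {?e}. v \<in> e} \<union> ({e \<in> ?L. v \<in> e} \<union> {e \<in> ?R. v \<in> e})"
    unfolding edges_from.simps by blast
  moreover have "card ({e \<in> {?e}. v \<in> e} \<union> ({e \<in> ?L. v \<in> e} \<union> {e \<in> ?R. v \<in> e}))
      = card {e \<in> {?e}. v \<in> e} + card ({e \<in> ?L. v \<in> e} \<union> {e \<in> ?R. v \<in> e})"
  proof (rule card_Un_disjoint)
    show "{e \<in> {?e}. v \<in> e} \<inter> ({e \<in> ?L. v \<in> e} \<union> {e \<in> ?R. v \<in> e}) = {}"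
      using edges_from_Tri_disjoint(1)[of a l r] by blast
  qed (use fin in simp_all)
  moreover have "card ({e \<in> ?L. v \<in> e} \<union> {e \<in> ?R. v \<in> e}) = card {e \<in> ?L. v \<in> e} + card {e \<in> ?R. v \<in> e}"
  proof (rule card_Un_disjoint)
    show "{e \<in> ?L. v \<in> e} \<inter> {e \<in> ?R. v \<in> e} = {}"
      using edges_from_Tri_disjoint(2)[of l a r] by blast
  qed (use fin in simp_all)
  moreover have "card {e \<in> {?e}. v \<in> e} = (if v \<in> ?e then 1 else 0)"
  proof (cases "v \<in> ?e")
    case True
    then have s: "{e \<in> {?e}. v \<in> e} = {?e}" by blast
    show ?thesis unfolding s using True by simp
  next
    case False
    then have s: "{e \<in> {?e}. v \<in> e} = {}" by blast
    show ?thesis unfolding s using False by simp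
  qed
  ultimately show ?thesis unfolding degree_def by (simp only: add.assoc)
qed

lemma degree_edges_from_outside:
  assumes "v \<notin> {a..a + width t}"
  shows "degree (edges_from t a) v = 0"
proof -
  have none: "{e \<in> edges_from t a. v \<in> e} = {}" using edges_from_subset assms by blast
  show ?thesis unfolding degree_def none by simp
qed

lemma degree_edges_from_ends:
  "degree (edges_from t a) a = ldeg t \<and> degree (edges_from t a) (a + width t) = rdeg t"
proof (induction t arbitrary: a)
  case Edge
  have "{e. e = {a, Suc a} \<and> a \<in> e} = {{a, Suc a}}" "{e. e = {a, Suc a} \<and> Suc a \<in> e} = {{a, Suc a}}" by auto
  then show ?case by (simp add: degree_def)
next
  case (Tri l r)
  have "degree (edges_from r (a + width l)) a = 0" "degree (edges_from l a) (a + width l + width r) = 0"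
    using width_pos[of l] width_pos[of r] by (auto intro!: degree_edges_from_outside)
  then show ?case using Tri.IH(1)[of a] Tri.IH(2)[of "a + width l"]
    by (simp add: degree_edges_from_Tri add.assoc del: edges_from.simps)
qed

text \<open>Only the apex of the root triangle lies in both sides, and its degrees there add up;
  every other inner vertex keeps the degree it has in its side.\<close>

lemma card_inner_degree:
  "card {v. a < v \<and> v < a + width t \<and> degree (edges_from t a) v = d} = inner_count t d"
proof (induction t arbitrary: a)
  case Edge
  have none: "{v. a < v \<and> v < a + width Edge \<and> degree (edges_from Edge a) v = d} = {}" by auto
  show ?case unfolding none by simp
next
  case (Tri l r)
  let ?m = "a + width l" and ?b = "a + width l + width r"
  let ?D = "degree (edges_from (Tri l r) a)"
  let ?A = "{v. a < v \<and> v < ?m \<and> degree (edges_from l a) v = d}"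
  let ?B = "{v. ?m < v \<and> v < ?b \<and> degree (edges_from r ?m) v = d}"
  let ?M = "if rdeg l + ldeg r = d then {?m} else {}"
  have w: "width l \<ge> 1" "width r \<ge> 1" by (rule width_pos)+
  have dl: "?D v = degree (edges_from l a) v" if "a < v" "v < ?m" for v
    using that by (simp add: degree_edges_from_Tri degree_edges_from_outside del: edges_from.simps)
  have dr: "?D v = degree (edges_from r ?m) v" if "?m < v" "v < ?b" for v
    using that by (simp add: degree_edges_from_Tri degree_edges_from_outside del: edges_from.simps)
  have dm: "?D ?m = rdeg l + ldeg r"
    using w degree_edges_from_ends[of l a] degree_edges_from_ends[of r ?m] by (simp add: degree_edges_from_Tri del: edges_from.simps)
  have "{v. a < v \<and> v < a + width (Tri l r) \<and> ?D v = d} = ?A \<union> ?B \<union> ?M"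
  proof (rule set_eqI)
    fix v
    consider "v \<le> a \<or> ?b \<le> v" | "a < v" "v < ?m" | "v = ?m" | "?m < v" "v < ?b" by linarith
    then show "v \<in> {v. a < v \<and> v < a + width (Tri l r) \<and> ?D v = d} \<longleftrightarrow> v \<in> ?A \<union> ?B \<union> ?M"
    proof cases
      case 1
      then show ?thesis using w by auto
    next
      case 2
      then show ?thesis using dl by auto
    next
      case 3
      then show ?thesis using dm w by auto
    next
      case 4
      then show ?thesis using dr by auto
    qed
  qed
  moreover have "card (?A \<union> ?B \<union> ?M) = card (?A \<union> ?B) + card ?M"
    by (rule card_Un_disjoint) auto
  moreover have "card (?A \<union> ?B) = card ?A + card ?B"
    by (rule card_Un_disjoint) auto
  ultimately show ?case using Tri.IH(1)[of a] Tri.IH(2)[of ?m] by simp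
qed

text \<open>With \<open>width t + 1\<close> vertices and \<open>2 * width t - 1\<close> edges the
  edge bound is attained, so an additional edge would violate it.\<close>

lemma maximal_outerplanar_triangulation: "maximal_outerplanar {0..width t} (edges_from t 0)"
proof -
  have G: "simple_graph {0..width t} (edges_from t 0)"
    unfolding simple_graph_def using edges_from_subset[of _ t 0] by auto
  have "outerplanar {0..width t} (edges_from t 0)"
    by (rule noncrossing_imp_outerplanar[OF G _ noncrossing_edges_from]) simp
  moreover have "\<not> outerplanar {0..width t} (insert {u, v} (edges_from t 0))"
    if uv: "u \<in> {0..width t}" "v \<in> {0..width t}" "u \<noteq> v \<and> {u, v} \<notin> edges_from t 0" for u v
  proof
    assume "outerplanar {0..width t} (insert {u, v} (edges_from t 0))"
    moreover have G': "simple_graph {0..width t} (insert {u, v} (edges_from t 0))"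
      using G uv unfolding simple_graph_def by auto
    moreover have all: "{e \<in> insert {u, v} (edges_from t 0). e \<subseteq> {0..width t}} = insert {u, v} (edges_from t 0)"
      using G' unfolding simple_graph_def by auto
    ultimately have "card (insert {u, v} (edges_from t 0)) + 3 \<le> 2 * card {0..width t}"
      using outerplanar_card_edges[of "{0..width t}" "insert {u, v} (edges_from t 0)" "{0..width t}"]
        width_pos[of t] by simp
    then show False using uv card_edges_from[of t 0] finite_edges_from[of t 0] by simp
  qed
  ultimately show ?thesis unfolding maximal_outerplanar_def using G by blast
qed

definition degree_count :: "triangulation \<Rightarrow> nat \<Rightarrow> nat" where
  "degree_count t d = inner_count t d + (if ldeg t = d then 1 else 0) + (if rdeg t = d then 1 else 0)"

lemma card_degree_le: "card {v \<in> {0..width t}. degree (edges_from t 0) v = d} \<le> degree_count t d"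
proof -
  let ?D = "degree (edges_from t 0)"
  let ?A = "{v. 0 < v \<and> v < 0 + width t \<and> ?D v = d}"
  let ?L = "if ldeg t = d then {0 :: nat} else {}" and ?R = "if rdeg t = d then {width t} else {}"
  have "{v \<in> {0..width t}. ?D v = d} \<subseteq> ?A \<union> ?L \<union> ?R"
  proof
    fix v assume v: "v \<in> {v \<in> {0..width t}. ?D v = d}"
    then consider "v = 0" | "v = width t" | "0 < v" "v < width t" by fastforce
    then show "v \<in> ?A \<union> ?L \<union> ?R"
      by cases (use v degree_edges_from_ends[of t 0] in auto)
  qed
  then have "card {v \<in> {0..width t}. ?D v = d} \<le> card (?A \<union> ?L \<union> ?R)"
    by (intro card_mono) auto
  also have "\<dots> \<le> card ?A + card ?L + card ?R"
    by (rule order_trans[OF card_Un_le add_right_mono[OF card_Un_le]])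
  also have "\<dots> = degree_count t d"
    using card_inner_degree[of 0 t d] unfolding degree_count_def by simp
  finally show ?thesis .
qed

lemma MOP_le_triangulation:
  assumes "\<And>d. (\<Sum>i=d..d+k. degree_count t i) \<le> M"
  shows "MOP (width t + 1) k \<le> M"
proof -
  let ?D = "degree (edges_from t 0)"
  have "MOP (width t + 1) k \<le> sp {0..width t} (edges_from t 0) k"
    by (rule MOP_le[OF maximal_outerplanar_triangulation]) simp
  also have "\<dots> \<le> M"
  proof (rule sp_le)
    fix d
    have "{v \<in> {0..width t}. d \<le> ?D v \<and> ?D v \<le> d + k} = (\<Union>i\<in>{d..d+k}. {v \<in> {0..width t}. ?D v = i})" by auto
    then have "card {v \<in> {0..width t}. d \<le> ?D v \<and> ?D v \<le> d + k}
        \<le> (\<Sum>i=d..d+k. card {v \<in> {0..width t}. ?D v = i})"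
      using card_UN_le[of "{d..d+k}"] by simp
    also have "\<dots> \<le> (\<Sum>i=d..d+k. degree_count t i)" by (intro sum_mono card_degree_le)
    finally show "card {v \<in> {0..width t}. d \<le> ?D v \<and> ?D v \<le> d + k} \<le> M" using assms[of d] by linarith
  qed auto
  finally show ?thesis .
qed

section \<open>Periodic strips and their degree counts\<close>

abbreviation ear :: "triangulation \<Rightarrow> triangulation" where
  "ear t \<equiv> Tri (Tri Edge Edge) t"

text \<open>A step completes five vertices, of degrees 2 to 6: the fan on the left has inner
  vertices of degrees 2 and 3 and its left end gets 4, while the old right and left ends of the
  strip grow to 5 and 6. The new ends again have degrees 3 and 2, so the step can be
  repeated.\<close>

fun strip0 :: "nat \<Rightarrow> triangulation" where
  "strip0 0 = ear Edge"
| "strip0 (Suc q) = Tri (Tri Edge (Tri (Tri Edge (Tri Edge Edge)) (strip0 q))) Edge"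

text \<open>An \<open>ear\<close> adds a vertex of degree 2 and a new left end, and gives the old
  left end 2 more. A step thus turns the ends of degrees 4 and 2 into inner vertices of degrees 6
  and 4.\<close>

fun strip1 :: "nat \<Rightarrow> triangulation" where
  "strip1 0 = Tri (ear Edge) Edge"
| "strip1 (Suc q) = Tri (ear (strip1 q)) Edge"

text \<open>The five ears of a step give five vertices of degree 2; the old left end gets degree
  \<open>2 + 4\<close>, the four intermediate left ends \<open>2 + 3\<close>. The right end gains
  one from each ear and one from the last triangle, growing from 2 to 8.\<close>

fun strip2 :: "nat \<Rightarrow> triangulation" where
  "strip2 0 = Tri (ear Edge) Edge"
| "strip2 (Suc q) = Tri (ear (ear (ear (ear (ear (strip2 q)))))) Edge"

text \<open>The bare strip on \<open>n = 11 * q + 5\<close> vertices has \<open>5 * q + 5\<close>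
  vertices of degree 2 to 4, one more than \<open>(5 * n + 19) / 11\<close> admits. The cap raises
  both ends of the strip, of degrees 4 and 2, to 5; it adds 11 vertices but only 4 to this window,
  while the bound grows by 5.\<close>

definition capped_strip2 :: "nat \<Rightarrow> triangulation" where
  "capped_strip2 q = ear (ear (ear (ear (Tri (Tri Edge (strip2 q)) (Tri Edge Edge)))))"

lemma strip0_ends: "ldeg (strip0 q) = 3" "rdeg (strip0 q) = 2" "width (strip0 q) = 5 * q + 3"
  by (induction q) auto

lemma strip1_ends: "ldeg (strip1 q) = 4" "rdeg (strip1 q) = 2" "width (strip1 q) = 3 * q + 4"
  by (induction q) auto

lemma strip2_ends: "ldeg (strip2 q) = 4" "rdeg (strip2 q) = 2" "width (strip2 q) = 11 * q + 4"
  by (induction q) auto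

lemma strip0_count: "inner_count (strip0 q) d =
  (if d = 2 \<or> d = 3 then q + 1 else if d = 4 \<or> d = 5 \<or> d = 6 then q else 0)"
  by (induction q) (auto simp: strip0_ends)

lemma strip1_count: "inner_count (strip1 q) d =
  (if d = 2 then q + 1 else if d = 3 then 2 else if d = 4 \<or> d = 6 then q else 0)"
  by (induction q) (auto simp: strip1_ends)

lemma strip2_count: "inner_count (strip2 q) d =
  (if d = 2 then 5 * q + 1 else if d = 3 then 2 else if d = 5 then 4 * q else if d = 6 \<or> d = 8 then q else 0)"
  by (induction q) (auto simp: strip2_ends)

lemma MOP_0_upper: "MOP (5 * q + 4) 0 \<le> q + 2"
proof -
  have "MOP (width (strip0 q) + 1) 0 \<le> q + 2"
    by (rule MOP_le_triangulation) (auto simp: degree_count_def strip0_count strip0_ends)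
  moreover have "width (strip0 q) + 1 = 5 * q + 4" by (simp add: strip0_ends)
  ultimately show ?thesis by metis
qed

lemma MOP_1_upper: "MOP (3 * q + 5) 1 \<le> q + 4"
proof -
  have "MOP (width (strip1 q) + 1) 1 \<le> q + 4"
    by (rule MOP_le_triangulation) (auto simp: degree_count_def strip1_count strip1_ends)
  moreover have "width (strip1 q) + 1 = 3 * q + 5" by (simp add: strip1_ends)
  ultimately show ?thesis by metis
qed

lemma MOP_2_upper: "MOP (11 * q + 16) 2 \<le> 5 * q + 9"
proof -
  have ends: "ldeg (capped_strip2 q) = 3" "rdeg (capped_strip2 q) = 7" "width (capped_strip2 q) = 11 * q + 15"
    by (simp_all add: capped_strip2_def strip2_ends)
  have count: "inner_count (capped_strip2 q) d =
    (if d = 2 then 5 * q + 6 else if d = 3 then 2 else if d = 5 then 4 * q + 6 else if d = 6 \<or> d = 8 then q else 0)" for d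
    by (simp add: capped_strip2_def strip2_ends strip2_count)
  have "MOP (width (capped_strip2 q) + 1) 2 \<le> 5 * q + 9"
  proof (rule MOP_le_triangulation)
    fix d
    have "{d..d+2} = {d, Suc d, Suc (Suc d)}" by auto
    then show "(\<Sum>i=d..d+2. degree_count (capped_strip2 q) i) \<le> 5 * q + 9"
      by (auto simp: degree_count_def count ends)
  qed
  moreover have "width (capped_strip2 q) + 1 = 11 * q + 16" by (simp add: ends)
  ultimately show ?thesis by metis
qed

theorem theorem3p2:
  shows "(\<forall>n::nat. n \<ge> 1 \<longrightarrow> real (MOP n 0) > real n / 5)
    \<and> (\<forall>n::nat. n \<ge> 2 \<longrightarrow> real (MOP n 1) \<ge> real n / 3 + 1)
    \<and> (\<forall>n::nat. n \<ge> 1 \<longrightarrow> real (MOP n 2) \<ge> 4 * real n / 9)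
    \<and> (\<forall>n p::nat. p \<ge> 2 \<and> n = 11 * p + 5 \<longrightarrow> real (MOP n 2) \<le> (5 * real n + 19) / 11)
    \<and> (\<forall>n k::nat. n \<ge> 1 \<and> k \<ge> 3 \<longrightarrow> real (MOP n k) \<ge> (real k - 2) * real n / (real k - 1))
    \<and> (\<exists>C::real. infinite {n::nat. n \<ge> 1 \<and> real (MOP n 0) \<le> real n / 5 + C}
             \<and> infinite {n::nat. n \<ge> 1 \<and> real (MOP n 1) \<le> real n / 3 + C})"
proof (intro conjI allI impI)
  have small: "n \<le> sp V E k" if "maximal_outerplanar V E" "card V = n" "n < 3" for V :: "nat set" and E n k
    using card_le_sp_small[of V E k] that unfolding maximal_outerplanar_def by simp
  show "real (MOP n 0) > real n / 5" if "n \<ge> 1" for n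
  proof -
    \<comment> \<open>\<open>MOP_ge\<close> transfers weak inequalities, so the strict bound is
      first sharpened by integrality.\<close>
    have "(real n + 1) / 5 \<le> real (MOP n 0)"
    proof (rule MOP_ge)
      fix V :: "nat set" and E assume V: "maximal_outerplanar V E" "card V = n"
      have "n < 5 * sp V E 0"
        using small[OF V, of 0] sp_0_lower[OF V(1)] V(2) that by (cases "n < 3") auto
      then show "(real n + 1) / 5 \<le> real (sp V E 0)" by simp
    qed
    then show ?thesis by simp
  qed
  \<comment> \<open>A single vertex has \<open>sp V E 1 = 1\<close>, below \<open>1 / 3 + 1\<close>;
    the bound starts at two vertices.\<close>
  show "real (MOP n 1) \<ge> real n / 3 + 1" if "n \<ge> 2" for n
  proof (rule MOP_ge)
    fix V :: "nat set" and E assume V: "maximal_outerplanar V E" "card V = n"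
    have "n + 3 \<le> 3 * sp V E 1"
      using small[OF V, of 1] sp_1_lower[OF V(1)] V(2) that by (cases "n < 3") auto
    then show "real n / 3 + 1 \<le> real (sp V E 1)" by simp
  qed
  show "real (MOP n 2) \<ge> 4 * real n / 9" if "n \<ge> 1" for n
  proof (rule MOP_ge)
    fix V :: "nat set" and E assume V: "maximal_outerplanar V E" "card V = n"
    have "4 * n \<le> 9 * sp V E 2"
      using small[OF V, of 2] sp_2_lower[OF V(1)] V(2) by (cases "n < 3") auto
    then show "4 * real n / 9 \<le> real (sp V E 2)" by simp
  qed
  show "real (MOP n 2) \<le> (5 * real n + 19) / 11" if pn: "p \<ge> 2 \<and> n = 11 * p + 5" for n p
  proof -
    \<comment> \<open>The strips are indexed by \<open>q = p - 1\<close>, and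
      \<open>5 * q + 9\<close> equals \<open>(5 * n + 19) / 11\<close> for
      \<open>n = 11 * q + 16\<close>.\<close>
    obtain q where q: "p = Suc q" using pn by (cases p) auto
    have n: "n = 11 * q + 16" using pn q by simp
    show ?thesis using MOP_2_upper[of q] unfolding n by simp
  qed
  show "real (MOP n k) \<ge> (real k - 2) * real n / (real k - 1)" if nk: "n \<ge> 1 \<and> k \<ge> 3" for n k
  proof (rule MOP_ge)
    fix V :: "nat set" and E assume V: "maximal_outerplanar V E" "card V = n"
    have "(k - 2) * n \<le> (k - 1) * sp V E k"
    proof (cases "n < 3")
      case True
      have "(k - 2) * n \<le> (k - 1) * n" by (intro mult_le_mono1) simp
      also have "\<dots> \<le> (k - 1) * sp V E k" using small[OF V True] by (intro mult_le_mono2)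
      finally show ?thesis .
    next
      case False
      then show ?thesis using sp_ge_3_lower[OF V(1)] V(2) nk by simp
    qed
    then have "real ((k - 2) * n) \<le> real ((k - 1) * sp V E k)" by (simp only: of_nat_le_iff)
    then have "(real k - 2) * real n \<le> (real k - 1) * real (sp V E k)" using nk by (simp add: of_nat_diff)
    then show "(real k - 2) * real n / (real k - 1) \<le> real (sp V E k)"
      using nk by (simp add: divide_le_eq mult.commute)
  qed
  show "\<exists>C::real. infinite {n::nat. n \<ge> 1 \<and> real (MOP n 0) \<le> real n / 5 + C}
             \<and> infinite {n::nat. n \<ge> 1 \<and> real (MOP n 1) \<le> real n / 3 + C}"
  \<comment> \<open>\<open>q + 2 = n / 5 + 6 / 5\<close> for \<open>n = 5 * q + 4\<close>, and
    \<open>q + 4 = n / 3 + 7 / 3\<close> for \<open>n = 3 * q + 5\<close>, so 3 serves both.\<close>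
  proof (intro exI[of _ 3] conjI)
    have "range (\<lambda>q. 5 * q + 4) \<subseteq> {n::nat. n \<ge> 1 \<and> real (MOP n 0) \<le> real n / 5 + 3}"
    proof clarify
      fix q :: nat
      have "real (MOP (5 * q + 4) 0) \<le> real (q + 2)" using MOP_0_upper[of q] by (simp only: of_nat_le_iff)
      then show "1 \<le> 5 * q + 4 \<and> real (MOP (5 * q + 4) 0) \<le> real (5 * q + 4) / 5 + 3" by (simp add: field_simps)
    qed
    moreover have "infinite (range (\<lambda>q::nat. 5 * q + 4))" by (intro range_inj_infinite injI) simp
    ultimately show "infinite {n::nat. n \<ge> 1 \<and> real (MOP n 0) \<le> real n / 5 + 3}" by (rule infinite_super)
    have "range (\<lambda>q. 3 * q + 5) \<subseteq> {n::nat. n \<ge> 1 \<and> real (MOP n 1) \<le> real n / 3 + 3}"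
    proof clarify
      fix q :: nat
      have "real (MOP (3 * q + 5) 1) \<le> real (q + 4)" using MOP_1_upper[of q] by (simp only: of_nat_le_iff)
      then show "1 \<le> 3 * q + 5 \<and> real (MOP (3 * q + 5) 1) \<le> real (3 * q + 5) / 3 + 3" by (simp add: field_simps)
    qed
    moreover have "infinite (range (\<lambda>q::nat. 3 * q + 5))" by (intro range_inj_infinite injI) simp
    ultimately show "infinite {n::nat. n \<ge> 1 \<and> real (MOP n 1) \<le> real n / 3 + 3}" by (rule infinite_super)
  qed
qed

end
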